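(* Let $f(X)\in\mathbb{Z}[X]$ be a polynomial of degree $n\ge 1$. Let $S$ be a finite set of primes, and let $S'\subseteq S$ be the subset of all $p\in S$ such that $f$ has a root in $\mathbb{Z}_p$. Suppose that $s':=\#S'\ge 1$. For real $B>0$ let $$\widetilde{N}(f,S,\varepsilon,B):=\#\{x\in\mathbb{Z} : |x|\le B,\ 0<|f(x)|^{\varepsilon}\le [f(x)]_{f,S}\}.$$ Then, for any $\varepsilon\in(0,R_{S'}(f)/n)$, one has $$\widetilde{N}(f,S,\varepsilon,B)\asymp_{f,S,\varepsilon} B^{1-(n\varepsilon)/R_{S'}(f)}(\log B)^{s'-1}\quad\text{as } B\to\infty.$$
   Context: $\mathbb{Z}_p$ is the ring of $p$-adic integers and $v_p$ the $p$-adic valuation. For $p\in S'$, $R_p(f)$ denotes the largest multiplicity of a root of $f$ in $\mathbb{Z}_p$, and $R_{S'}(f):=\max_{p\in S'}R_p(f)$. For $p\in S$ put $r_{p,S}(f):=R_{S'}(f)/R_p(f)$ if $p\in S'$ and $r_{p,S}(f):=1$ if $p\in S\setminus S'$. The $f$-normalized $S$-part of a non-zero integer $y$ is $[y]_{f,S}:=\prod_{p\in S}p^{v_p(y)\,r_{p,S}(f)}$. The variable $B$ ranges over the positive reals. $F(B)\asymp_{f,S,\varepsilon} G(B)$ as $B\to\infty$ means that there are constants $c_1,c_2>0$ depending only on $f,S,\varepsilon$ such that $c_1G(B)\le F(B)\le c_2G(B)$ for all sufficiently large $B$. *)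

theory Defs
  imports
    Complex_Main
    "HOL-Algebra.Polynomial_Divisibility"
    "HOL-Computational_Algebra.Computational_Algebra"
begin

section \<open>The ring of p-adic integers\<close>

text \<open>
  The ring of p-adic integers is the inverse limit of the rings of integers modulo \<open>p ^ n\<close>:
  an element is a sequence \<open>x\<close> whose \<open>n\<close>-th entry is the representative of a residue class
  modulo \<open>p ^ n\<close> in \<open>{0..<p ^ n}\<close>, and the entries are compatible with reduction. (The
  condition for \<open>m = n\<close> says that the representatives are reduced.)
\<close>

definition padic_ints :: "nat \<Rightarrow> (nat \<Rightarrow> int) ring" where
  "padic_ints p =
    \<lparr> carrier = {x. \<forall>m n. m \<le> n \<longrightarrow> x m = x n mod int p ^ m},
      mult = (\<lambda>x y n. (x n * y n) mod int p ^ n),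
      one = (\<lambda>n. 1 mod int p ^ n),
      zero = (\<lambda>n. 0),
      add = (\<lambda>x y n. (x n + y n) mod int p ^ n) \<rparr>"

definition padic_of_int :: "nat \<Rightarrow> int \<Rightarrow> (nat \<Rightarrow> int)" where
  "padic_of_int p k = (\<lambda>n. k mod int p ^ n)"

lemma padic_of_int_in_carrier: "padic_of_int p k \<in> carrier (padic_ints p)"
  by (auto simp: padic_ints_def padic_of_int_def mod_mod_cancel le_imp_power_dvd)

lemma padic_of_int_add:
  "padic_of_int p (k + l) = padic_of_int p k \<oplus>\<^bsub>padic_ints p\<^esub> padic_of_int p l"
  by (simp add: padic_ints_def padic_of_int_def mod_add_eq)

lemma padic_of_int_mult:
  "padic_of_int p (k * l) = padic_of_int p k \<otimes>\<^bsub>padic_ints p\<^esub> padic_of_int p l"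
  by (simp add: padic_ints_def padic_of_int_def mod_mult_eq)

lemma padic_of_int_0: "padic_of_int p 0 = \<zero>\<^bsub>padic_ints p\<^esub>"
  by (simp add: padic_ints_def padic_of_int_def)

lemma padic_of_int_1: "padic_of_int p 1 = \<one>\<^bsub>padic_ints p\<^esub>"
  by (simp add: padic_ints_def padic_of_int_def)

lemma padic_of_int_eq_0_iff:
  assumes "prime p"
  shows "padic_of_int p k = \<zero>\<^bsub>padic_ints p\<^esub> \<longleftrightarrow> k = 0"
proof
  assume *: "padic_of_int p k = \<zero>\<^bsub>padic_ints p\<^esub>"
  have dvd: "int p ^ n dvd k" for n
    using fun_cong[OF *, of n] by (simp add: padic_ints_def padic_of_int_def mod_eq_0_iff_dvd)
  show "k = 0"
  proof (rule ccontr)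
    assume "k \<noteq> 0"
    moreover have "\<not> is_unit (int p)"
      using assms by (auto dest: not_prime_unit)
    ultimately have "finite {n. int p ^ n dvd k}"
      using finite_divisor_powers by blast
    with dvd show False by simp
  qed
qed (simp add: padic_of_int_0)

lemma cring_padic_ints: "cring (padic_ints p)"
proof (rule cringI)
  have compat: "x m = x n mod int p ^ m" if "x \<in> carrier (padic_ints p)" "m \<le> n" for x m n
    using that by (simp add: padic_ints_def)
  have red: "x n mod int p ^ n = x n" if "x \<in> carrier (padic_ints p)" for x n
    using compat[OF that, of n n] by simp
  have dvd: "int p ^ m dvd int p ^ n" if "m \<le> n" for m n
    using that by (rule le_imp_power_dvd)
  have add_closed: "x \<oplus>\<^bsub>padic_ints p\<^esub> y \<in> carrier (padic_ints p)"
    if "x \<in> carrier (padic_ints p)" "y \<in> carrier (padic_ints p)" for x y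
    unfolding padic_ints_def
  proof (clarsimp)
    fix m n :: nat assume "m \<le> n"
    then show "(x m + y m) mod int p ^ m = (x n + y n) mod int p ^ n mod int p ^ m"
      using compat[OF that(1), of m n] compat[OF that(2), of m n]
      by (simp add: mod_mod_cancel[OF dvd] mod_add_eq)
  qed
  have mult_closed: "x \<otimes>\<^bsub>padic_ints p\<^esub> y \<in> carrier (padic_ints p)"
    if "x \<in> carrier (padic_ints p)" "y \<in> carrier (padic_ints p)" for x y
    unfolding padic_ints_def
  proof (clarsimp)
    fix m n :: nat assume "m \<le> n"
    then show "x m * y m mod int p ^ m = x n * y n mod int p ^ n mod int p ^ m"
      using compat[OF that(1), of m n] compat[OF that(2), of m n]
      by (simp add: mod_mod_cancel[OF dvd] mod_mult_eq)
  qed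
  show "abelian_group (padic_ints p)"
  proof (rule abelian_groupI)
    fix x assume x: "x \<in> carrier (padic_ints p)"
    let ?y = "\<lambda>n. (- x n) mod int p ^ n"
    have "?y \<in> carrier (padic_ints p)"
      unfolding padic_ints_def
    proof (clarsimp)
      fix m n :: nat assume "m \<le> n"
      then show "- x m mod int p ^ m = (- x n) mod int p ^ n mod int p ^ m"
        using compat[OF x, of m n] by (simp add: mod_mod_cancel[OF dvd] mod_minus_eq)
    qed
    moreover have "?y \<oplus>\<^bsub>padic_ints p\<^esub> x = \<zero>\<^bsub>padic_ints p\<^esub>"
      by (simp add: padic_ints_def mod_simps)
    ultimately show "\<exists>y\<in>carrier (padic_ints p). y \<oplus>\<^bsub>padic_ints p\<^esub> x = \<zero>\<^bsub>padic_ints p\<^esub>" by blast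
    show "\<zero>\<^bsub>padic_ints p\<^esub> \<oplus>\<^bsub>padic_ints p\<^esub> x = x"
      using red[OF x] by (simp add: padic_ints_def)
  next
    show "x \<oplus>\<^bsub>padic_ints p\<^esub> y = y \<oplus>\<^bsub>padic_ints p\<^esub> x" for x y
      by (simp add: padic_ints_def add.commute)
    show "x \<oplus>\<^bsub>padic_ints p\<^esub> y \<oplus>\<^bsub>padic_ints p\<^esub> z
        = x \<oplus>\<^bsub>padic_ints p\<^esub> (y \<oplus>\<^bsub>padic_ints p\<^esub> z)" for x y z
      by (simp add: padic_ints_def mod_add_left_eq mod_add_right_eq add.assoc)
    show "\<zero>\<^bsub>padic_ints p\<^esub> \<in> carrier (padic_ints p)"
      by (simp add: padic_ints_def)
  qed (use add_closed in auto)
  show "comm_monoid (padic_ints p)"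
  proof (rule comm_monoidI)
    fix x assume x: "x \<in> carrier (padic_ints p)"
    show "\<one>\<^bsub>padic_ints p\<^esub> \<otimes>\<^bsub>padic_ints p\<^esub> x = x"
      using red[OF x] by (simp add: padic_ints_def mod_simps)
  next
    show "\<one>\<^bsub>padic_ints p\<^esub> \<in> carrier (padic_ints p)"
      using padic_of_int_in_carrier[of p 1] by (simp add: padic_of_int_1)
    show "x \<otimes>\<^bsub>padic_ints p\<^esub> y = y \<otimes>\<^bsub>padic_ints p\<^esub> x" for x y
      by (simp add: padic_ints_def mult.commute)
    show "x \<otimes>\<^bsub>padic_ints p\<^esub> y \<otimes>\<^bsub>padic_ints p\<^esub> z
        = x \<otimes>\<^bsub>padic_ints p\<^esub> (y \<otimes>\<^bsub>padic_ints p\<^esub> z)" for x y z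
      by (simp add: padic_ints_def mod_mult_left_eq mod_mult_right_eq mult.assoc)
  qed (use mult_closed in auto)
  show "(x \<oplus>\<^bsub>padic_ints p\<^esub> y) \<otimes>\<^bsub>padic_ints p\<^esub> z
      = x \<otimes>\<^bsub>padic_ints p\<^esub> z \<oplus>\<^bsub>padic_ints p\<^esub> y \<otimes>\<^bsub>padic_ints p\<^esub> z" for x y z
    by (simp add: padic_ints_def mod_mult_left_eq mod_add_eq distrib_right)
qed

lemma domain_padic_ints:
  assumes p: "prime p"
  shows "domain (padic_ints p)"
proof -
  interpret cring "padic_ints p" by (rule cring_padic_ints)
  have prime: "prime (int p)" using p by simp
  show ?thesis
  proof
    show "\<one>\<^bsub>padic_ints p\<^esub> \<noteq> \<zero>\<^bsub>padic_ints p\<^esub>"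
      using padic_of_int_eq_0_iff[OF p, of 1] by (simp add: padic_of_int_1)
  next
    fix x y
    assume xy: "x \<otimes>\<^bsub>padic_ints p\<^esub> y = \<zero>\<^bsub>padic_ints p\<^esub>"
      and x: "x \<in> carrier (padic_ints p)" and y: "y \<in> carrier (padic_ints p)"
    show "x = \<zero>\<^bsub>padic_ints p\<^esub> \<or> y = \<zero>\<^bsub>padic_ints p\<^esub>"
    proof (rule ccontr)
      assume "\<not> ?thesis"
      then obtain k l where k: "x k \<noteq> 0" and l: "y l \<noteq> 0"
        by (auto simp: padic_ints_def fun_eq_iff)
      define n where "n = k + l"
      have "x k = x n mod int p ^ k" "y l = y n mod int p ^ l"
        using x y by (auto simp: padic_ints_def n_def)
      with k l have nd: "\<not> int p ^ k dvd x n" "\<not> int p ^ l dvd y n"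
        by (auto simp: mod_eq_0_iff_dvd)
      then have nz: "x n \<noteq> 0" "y n \<noteq> 0" by auto
      have "multiplicity (int p) (x n) < k" "multiplicity (int p) (y n) < l"
        using nd by (meson linorder_not_less multiplicity_dvd' )+
      then have "multiplicity (int p) (x n * y n) < n"
        using nz prime by (simp add: prime_elem_multiplicity_mult_distrib n_def)
      moreover have "int p ^ n dvd x n * y n"
        using fun_cong[OF xy, of n] by (simp add: padic_ints_def mod_eq_0_iff_dvd)
      then have "n \<le> multiplicity (int p) (x n * y n)"
        using nz prime by (intro multiplicity_geI) (auto dest: not_prime_unit)
      ultimately show False by simp
    qed
  qed
qed

section \<open>Roots of integer polynomials in the p-adic integers\<close>

text \<open>
  In \<^theory>\<open>HOL-Algebra.Polynomials\<close> a polynomial over a ring is the list of its coefficients,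
  starting with the leading one.
\<close>

definition padic_poly :: "nat \<Rightarrow> int poly \<Rightarrow> (nat \<Rightarrow> int) list" where
  "padic_poly p f = map (padic_of_int p) (rev (coeffs f))"

lemma padic_poly_in_carrier:
  assumes "prime p"
  shows "padic_poly p f \<in> carrier (poly_ring (padic_ints p))"
proof (cases "f = 0")
  case False
  then have "hd (padic_poly p f) = padic_of_int p (lead_coeff f)"
    by (simp add: padic_poly_def hd_map hd_rev last_coeffs_eq_coeff_degree)
  with False show ?thesis
    using padic_of_int_eq_0_iff[OF assms, of "lead_coeff f"] padic_of_int_in_carrier[of p]
    by (auto simp: univ_poly_carrier[symmetric] polynomial_def padic_poly_def)
qed (simp add: padic_poly_def univ_poly_carrier[symmetric] polynomial_def)

text \<open>
  \<open>is_padic_root p f a\<close> includes that \<open>a\<close> is a p-adic integer; \<open>padic_root_mult p f a\<close> is the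
  largest \<open>m\<close> such that \<open>(X - a) ^ m\<close> divides \<open>f\<close> in the ring of polynomials over the p-adic
  integers.
\<close>

definition is_padic_root :: "nat \<Rightarrow> int poly \<Rightarrow> (nat \<Rightarrow> int) \<Rightarrow> bool" where
  "is_padic_root p f a \<longleftrightarrow> ring.is_root (padic_ints p) (padic_poly p f) a"

definition padic_root_mult :: "nat \<Rightarrow> int poly \<Rightarrow> (nat \<Rightarrow> int) \<Rightarrow> nat" where
  "padic_root_mult p f a = ring.alg_mult (padic_ints p) (padic_poly p f) a"

definition root_primes :: "int poly \<Rightarrow> nat set \<Rightarrow> nat set" where
  "root_primes f S = {p \<in> S. \<exists>a. is_padic_root p f a}"

text \<open>The two maxima below are only meaningful if \<open>f\<close> has a p-adic integral root, respectively
  if \<open>root_primes f S\<close> is non-empty.\<close>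

definition max_root_mult :: "int poly \<Rightarrow> nat \<Rightarrow> nat" where
  "max_root_mult f p = Max {padic_root_mult p f a | a. is_padic_root p f a}"

definition max_root_mult_on :: "int poly \<Rightarrow> nat set \<Rightarrow> nat" where
  "max_root_mult_on f S = Max (max_root_mult f ` root_primes f S)"

section \<open>The normalized S-part and the counting function\<close>

definition norm_exponent :: "int poly \<Rightarrow> nat set \<Rightarrow> nat \<Rightarrow> real" where
  "norm_exponent f S p =
    (if p \<in> root_primes f S then real (max_root_mult_on f S) / real (max_root_mult f p) else 1)"

definition normalized_S_part :: "int poly \<Rightarrow> nat set \<Rightarrow> int \<Rightarrow> real" where
  "normalized_S_part f S y =
    (\<Prod>p\<in>S. real p powr (real (multiplicity (int p) y) * norm_exponent f S p))"

definition count_S_part :: "int poly \<Rightarrow> nat set \<Rightarrow> real \<Rightarrow> real \<Rightarrow> nat" where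
  "count_S_part f S \<epsilon> B =
    card {x :: int. \<bar>real_of_int x\<bar> \<le> B \<and>
      0 < \<bar>real_of_int (poly f x)\<bar> powr \<epsilon> \<and>
      \<bar>real_of_int (poly f x)\<bar> powr \<epsilon> \<le> normalized_S_part f S (poly f x)}"

end

theory Submission
  imports Defs "HOL-Number_Theory.Cong" "HOL-Real_Asymp.Real_Asymp"
begin

text \<open>
  For \<open>p \<in> S'\<close> the valuation of \<open>f x\<close> is at most \<open>R\<^sub>p\<close> times the largest \<open>k\<close> with
  \<open>x \<equiv> a (mod p ^ k)\<close> for some \<open>p\<close>-adic root \<open>a\<close> of \<open>f\<close>, up to a bounded error: locally this
  follows from \<open>f = (X - a) ^ m * G\<close> with \<open>G a \<noteq> 0\<close>, globally from the compactness of the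
  \<open>p\<close>-adic integers. Conversely it is at least \<open>R\<^sub>p * k\<close> if \<open>a\<close> is a root of maximal
  multiplicity. As the normalization replaces every \<open>R\<^sub>p\<close> by \<open>R\<close>, the condition on \<open>x\<close> says, up to
  constants, that \<open>x\<close> is congruent to roots modulo powers \<open>p ^ k\<^sub>p\<close> whose product is at least
  \<open>\<bar>x\<bar> powr (n * \<epsilon> / R)\<close>. The tuples \<open>k\<close> for which this product lies within a constant factor of
  a given \<open>T\<close> number about \<open>(ln T) ^ (s' - 1)\<close>, since one exponent is determined by the others up to
  finitely many choices, and each contributes about \<open>B / T\<close> integers up to \<open>B\<close>. The upper bound sums
  this over dyadic ranges of \<open>\<bar>x\<bar>\<close>; the lower bound prescribes the exponents \<open>k\<close> exactly, which
  makes the contributions disjoint.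
\<close>

section \<open>Valuations of polynomial values\<close>

abbreviation padic_root_set :: "int poly \<Rightarrow> nat \<Rightarrow> (nat \<Rightarrow> int) set" where
  "padic_root_set f p \<equiv> {a. is_padic_root p f a}"

section \<open>Entries of sums, products, powers and polynomial values of p-adic integers\<close>

lemma padic_ints_compat:
  "a \<in> carrier (padic_ints p) \<Longrightarrow> m \<le> n \<Longrightarrow> a n mod int p ^ m = a m"
  by (simp add: padic_ints_def)

lemma padic_add_entry: "(x \<oplus>\<^bsub>padic_ints p\<^esub> y) N = (x N + y N) mod int p ^ N"
  and padic_mult_entry: "(x \<otimes>\<^bsub>padic_ints p\<^esub> y) N = (x N * y N) mod int p ^ N"
  by (simp_all add: padic_ints_def)

lemma padic_root_in_carrier:
  "is_padic_root p f a \<Longrightarrow> a \<in> carrier (padic_ints p)"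
  using ring.is_root_def[OF cring.axioms(1)[OF cring_padic_ints]] by (auto simp: is_padic_root_def)

lemma padic_pow_entry:
  "(x [^]\<^bsub>padic_ints p\<^esub> (n::nat)) N = (x N) ^ n mod int p ^ N"
proof -
  interpret cring "padic_ints p" by (rule cring_padic_ints)
  show ?thesis
  proof (induction n)
    case 0
    have "x [^]\<^bsub>padic_ints p\<^esub> (0::nat) = \<one>\<^bsub>padic_ints p\<^esub>" by simp
    then show ?case by (simp add: padic_ints_def)
  next
    case (Suc n)
    have "(x [^]\<^bsub>padic_ints p\<^esub> Suc n) N = ((x [^]\<^bsub>padic_ints p\<^esub> n) N * x N) mod int p ^ N"
      by (simp add: padic_ints_def)
    with Suc show ?case by (simp add: mod_mult_right_eq mult.commute)
  qed
qed

text \<open>This is the p-adic continuity of polynomials: evaluation is built from ring operations,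
  and these act entry by entry modulo \<open>p ^ N\<close>.\<close>

lemma padic_eval_entry_cong:
  assumes "x N = y N"
  shows "ring.eval (padic_ints p) F x N = ring.eval (padic_ints p) F y N"
proof -
  interpret cring "padic_ints p" by (rule cring_padic_ints)
  show ?thesis
  proof (induction F)
    case Nil
    then show ?case by simp
  next
    case (Cons c F)
    have pw: "(x [^]\<^bsub>padic_ints p\<^esub> n) N = (y [^]\<^bsub>padic_ints p\<^esub> n) N" for n :: nat
      by (simp only: padic_pow_entry assms)
    have "eval (c # F) z N
       = ((c N * (z [^]\<^bsub>padic_ints p\<^esub> (length F)) N) mod int p ^ N + eval F z N) mod int p ^ N" for z
      by (simp add: padic_add_entry padic_mult_entry)
    then show ?case by (simp only: pw Cons.IH)
  qed
qed

lemma padic_eval_of_int: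
  "ring.eval (padic_ints p) (padic_poly p f) (padic_of_int p x) = padic_of_int p (poly f x)"
proof -
  interpret cring "padic_ints p" by (rule cring_padic_ints)
  show ?thesis
  proof (induction f)
    case 0
    then show ?case by (simp add: padic_poly_def padic_of_int_0)
  next
    case (pCons a f)
    \<comment> \<open>The constant coefficient comes last in the list, so the induction follows
      Horner's rule. The hypotheses of \<open>pCons\<close> exclude \<open>a = 0\<close> with
      \<open>f = 0\<close>, where the list would stay empty.\<close>
    have "padic_poly p (pCons a f) = padic_poly p f @ [padic_of_int p a]"
      using pCons.hyps by (auto simp: padic_poly_def cCons_def)
    moreover have "set (padic_poly p f) \<subseteq> carrier (padic_ints p)"
      using padic_of_int_in_carrier by (auto simp: padic_poly_def)
    ultimately have "eval (padic_poly p (pCons a f)) (padic_of_int p x)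
       = eval (padic_poly p f) (padic_of_int p x) \<otimes>\<^bsub>padic_ints p\<^esub> padic_of_int p x
           \<oplus>\<^bsub>padic_ints p\<^esub> padic_of_int p a"
      by (simp add: eval_append_aux padic_of_int_in_carrier)
    also have "\<dots> = padic_of_int p (poly (pCons a f) x)"
      by (simp only: pCons.IH padic_of_int_mult[symmetric] padic_of_int_add[symmetric])
         (simp add: algebra_simps)
    finally show ?case .
  qed
qed

section \<open>Finiteness and multiplicities of the p-adic roots\<close>

lemma finite_padic_roots:
  assumes "prime p"
  shows "finite (padic_root_set f p)"
  using domain.finite_number_of_roots[OF domain_padic_ints[OF assms] padic_poly_in_carrier[OF assms]]
  by (simp add: is_padic_root_def)

lemma padic_poly_eq_Nil_iff: "padic_poly p f = [] \<longleftrightarrow> f = 0"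
  by (simp add: padic_poly_def)

lemma padic_root_mult_pos:
  assumes "prime p" "is_padic_root p f a"
  shows "padic_root_mult p f a > 0"
  using domain.alg_mult_gt_zero_iff_is_root[OF domain_padic_ints[OF assms(1)]
      padic_poly_in_carrier[OF assms(1)]] assms(2)
  by (simp add: is_padic_root_def padic_root_mult_def)

lemma padic_root_mult_le_max:
  assumes "prime p" "is_padic_root p f a"
  shows "padic_root_mult p f a \<le> max_root_mult f p"
  unfolding max_root_mult_def
  by (rule Max_ge) (use assms finite_padic_roots[OF assms(1), of f] in auto)

lemma max_root_mult_attained:
  assumes "prime p" "is_padic_root p f b"
  obtains a where "is_padic_root p f a" "padic_root_mult p f a = max_root_mult f p"
proof -
  have "max_root_mult f p \<in> {padic_root_mult p f a | a. is_padic_root p f a}"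
    unfolding max_root_mult_def
    by (rule Max_in) (use assms finite_padic_roots[OF assms(1), of f] in auto)
  then show ?thesis using that by auto
qed

section \<open>Valuations near a p-adic integer and, by compactness, everywhere\<close>

lemma padic_minus_entry:
  assumes "x \<in> carrier (padic_ints p)" "y \<in> carrier (padic_ints p)"
  shows "(x \<ominus>\<^bsub>padic_ints p\<^esub> y) N = (x N - y N) mod int p ^ N"
proof -
  interpret cring "padic_ints p" by (rule cring_padic_ints)
  let ?z = "x \<ominus>\<^bsub>padic_ints p\<^esub> y"
  have z: "?z \<in> carrier (padic_ints p)" using assms by simp
  \<comment> \<open>The ring record does not list the entries of an additive inverse, so the entry
    of the difference is found by solving \<open>x = z + y\<close>.\<close>
  have "x = ?z \<oplus>\<^bsub>padic_ints p\<^esub> y" using assms by algebra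
  then have "x N = (?z \<oplus>\<^bsub>padic_ints p\<^esub> y) N" by simp
  then have "x N = (?z N + y N) mod int p ^ N" by (simp add: padic_ints_def)
  then have "(x N - y N) mod int p ^ N = ?z N mod int p ^ N"
    by (simp add: mod_simps)
  with padic_ints_compat[OF z, of N N] show ?thesis by simp
qed

text \<open>Divide by the highest power of \<open>X - a\<close>. If the cofactor still vanished at
  \<open>a\<close>, one more linear factor would split off, against the maximality of the
  multiplicity. For a non-root \<open>a\<close> the multiplicity is 0. The identity is read in the
  \<open>N\<close>-th entry because \<open>a\<close> itself is not an integer, only its truncation
  \<open>a N\<close> is.\<close>

lemma padic_factor_at:
  assumes p: "prime p" and f: "f \<noteq> 0" and a: "a \<in> carrier (padic_ints p)"
  obtains G where "set G \<subseteq> carrier (padic_ints p)"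
    and "ring.eval (padic_ints p) G a \<noteq> \<zero>\<^bsub>padic_ints p\<^esub>"
    and "\<And>x N. [poly f x = (x - a N) ^ padic_root_mult p f a
           * ring.eval (padic_ints p) G (padic_of_int p x) N] (mod int p ^ N)"
proof -
  interpret domain "padic_ints p" by (rule domain_padic_ints[OF p])
  let ?R = "padic_ints p"
  interpret UP: domain "poly_ring ?R"
    using univ_poly_is_domain[OF carrier_is_subring] .
  define F where "F = padic_poly p f"
  define m where "m = alg_mult F a"
  define L where "L = [\<one>\<^bsub>?R\<^esub>, \<ominus>\<^bsub>?R\<^esub> a]"
  have F: "F \<in> carrier (poly_ring ?R)" "F \<noteq> []"
    using p f by (simp_all add: F_def padic_poly_in_carrier padic_poly_eq_Nil_iff)
  have L: "L \<in> carrier (poly_ring ?R)"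
    using a by (auto simp: L_def univ_poly_carrier[symmetric] polynomial_def)
  have "(L [^]\<^bsub>poly_ring ?R\<^esub> m) pdivides\<^bsub>?R\<^esub> F"
    using alg_multE(1)[OF a F] by (simp add: L_def m_def)
  then obtain G where G: "G \<in> carrier (poly_ring ?R)"
    and FG: "F = L [^]\<^bsub>poly_ring ?R\<^esub> m \<otimes>\<^bsub>poly_ring ?R\<^esub> G"
    by (auto simp: pdivides_def factor_def)
  have "set G \<subseteq> carrier ?R"
    using G by (auto simp: univ_poly_carrier[symmetric] polynomial_def)
  moreover have "eval G a \<noteq> \<zero>\<^bsub>?R\<^esub>"
  proof
    assume 0: "eval G a = \<zero>\<^bsub>?R\<^esub>"
    have "G \<noteq> []"
    proof
      assume "G = []"
      then have "G = \<zero>\<^bsub>poly_ring ?R\<^esub>" by (simp add: univ_poly_zero)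
      then have "F = \<zero>\<^bsub>poly_ring ?R\<^esub>" using FG L by simp
      with F show False by (simp add: univ_poly_zero)
    qed
    with 0 a have "is_root G a" by (simp add: is_root_def)
    from is_root_imp_pdivides[OF G this] obtain H where H: "H \<in> carrier (poly_ring ?R)"
      and GH: "G = L \<otimes>\<^bsub>poly_ring ?R\<^esub> H"
      by (auto simp: pdivides_def factor_def L_def)
    have "F = L [^]\<^bsub>poly_ring ?R\<^esub> (Suc m) \<otimes>\<^bsub>poly_ring ?R\<^esub> H"
      using FG GH L H by (simp add: UP.m_assoc)
    then have "(L [^]\<^bsub>poly_ring ?R\<^esub> (Suc m)) pdivides\<^bsub>?R\<^esub> F"
      using H by (auto simp: pdivides_def factor_def)
    then have "Suc m \<le> alg_mult F a"
      using alg_multE(2)[OF a F] by (simp add: L_def)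
    then show False by (simp add: m_def)
  qed
  moreover have "[poly f x = (x - a N) ^ padic_root_mult p f a
           * eval G (padic_of_int p x) N] (mod int p ^ N)" for x N
  proof -
    let ?x = "padic_of_int p x"
    note x = padic_of_int_in_carrier[of p x]
    interpret E: ring_hom_ring "poly_ring ?R" ?R "\<lambda>P. eval P ?x"
      by (rule eval_ring_hom[OF carrier_is_subring x])
    have "eval L ?x = ?x \<ominus>\<^bsub>?R\<^esub> a"
      using x a by (simp add: L_def a_minus_def)
    then have "eval F ?x = (?x \<ominus>\<^bsub>?R\<^esub> a) [^]\<^bsub>?R\<^esub> m \<otimes>\<^bsub>?R\<^esub> eval G ?x"
      using FG L G by (simp add: E.hom_nat_pow)
    then have "padic_of_int p (poly f x) N
        = ((?x \<ominus>\<^bsub>?R\<^esub> a) [^]\<^bsub>?R\<^esub> m \<otimes>\<^bsub>?R\<^esub> eval G ?x) N"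
      by (simp only: F_def padic_eval_of_int)
    also have "\<dots> = (((?x \<ominus>\<^bsub>?R\<^esub> a) [^]\<^bsub>?R\<^esub> m) N * eval G ?x N) mod int p ^ N"
      by (simp add: padic_ints_def)
    also have "\<dots> = ((x mod int p ^ N - a N) ^ m * eval G ?x N) mod int p ^ N"
      by (simp add: padic_pow_entry padic_minus_entry[OF x a] mod_simps)
         (simp add: padic_of_int_def mod_simps)
    also have "\<dots> = ((x - a N) ^ m * eval G ?x N) mod int p ^ N"
      by (metis (no_types, lifting) mod_diff_left_eq mod_mult_left_eq power_mod)
    finally show ?thesis
      by (simp add: Cong.cong_def padic_of_int_def m_def padic_root_mult_def F_def)
  qed
  ultimately show ?thesis by (rule that)
qed

text \<open>If \<open>p ^ j\<close> divides \<open>x - a N\<close>, its \<open>m\<close>-th power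
  divides the factor \<open>(x - a N) ^ m\<close> of \<open>poly f x\<close>.\<close>

lemma padic_root_power_dvd:
  assumes p: "prime p" and f: "f \<noteq> 0" and a: "a \<in> carrier (padic_ints p)"
    and x: "x mod int p ^ j = a j"
  shows "int p ^ (padic_root_mult p f a * j) dvd poly f x"
proof -
  let ?m = "padic_root_mult p f a"
  obtain G where G: "\<And>N. [poly f x = (x - a N) ^ ?m
           * ring.eval (padic_ints p) G (padic_of_int p x) N] (mod int p ^ N)"
    using padic_factor_at[OF p f a] by metis
  \<comment> \<open>\<open>N\<close> is at least \<open>j\<close>, so that \<open>a N\<close>
    reduces to \<open>a j\<close>, and at least \<open>m * j\<close>, so that a congruence modulo
    \<open>p ^ N\<close> decides divisibility by \<open>p ^ (m * j)\<close>.\<close>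
  define N where "N = ?m * j + j"
  have "a N mod int p ^ j = x mod int p ^ j"
    using padic_ints_compat[OF a, of j N] x by (simp add: N_def)
  then have "int p ^ j dvd x - a N" by (metis mod_eq_dvd_iff)
  then have "int p ^ (?m * j) dvd (x - a N) ^ ?m"
    by (metis dvd_power_same mult.commute power_mult)
  moreover have "int p ^ (?m * j) dvd int p ^ N" by (simp add: N_def le_imp_power_dvd)
  ultimately show ?thesis
    using G[of N] by (meson cong_dvd_iff cong_dvd_modulus dvd_mult2)
qed

text \<open>Up to the cofactor \<open>G\<close>, the valuation of \<open>poly f x\<close> is
  \<open>m\<close> times that of \<open>x - a\<close>. As \<open>G\<close> is non-zero at
  \<open>a\<close> modulo some \<open>p ^ K\<close>, it keeps that residue on the ball of radius
  \<open>p ^ (-K)\<close>, where it contributes less than \<open>K\<close>.\<close>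

lemma padic_valuation_near:
  assumes p: "prime p" and f: "f \<noteq> 0" and a: "a \<in> carrier (padic_ints p)"
  shows "\<exists>K. \<forall>x. x mod int p ^ K = a K \<longrightarrow> poly f x \<noteq> 0 \<longrightarrow>
    (\<exists>j. x mod int p ^ j = a j \<and> multiplicity (int p) (poly f x) \<le> padic_root_mult p f a * j + K)"
proof -
  interpret cring "padic_ints p" by (rule cring_padic_ints)
  let ?m = "padic_root_mult p f a"
  have pe: "prime_elem (int p)" and pu: "\<not> is_unit (int p)"
    using p by (auto dest: not_prime_unit)
  obtain G where Gc: "set G \<subseteq> carrier (padic_ints p)"
    and Ga: "eval G a \<noteq> \<zero>\<^bsub>padic_ints p\<^esub>"
    and G: "\<And>x N. [poly f x = (x - a N) ^ ?m * eval G (padic_of_int p x) N] (mod int p ^ N)"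
    using padic_factor_at[OF p f a] by metis
  obtain K where K: "eval G a K \<noteq> 0"
    using Ga by (auto simp: padic_ints_def fun_eq_iff)
  show ?thesis
  proof (rule exI[of _ K], intro allI impI)
    fix x assume x: "x mod int p ^ K = a K" and fx: "poly f x \<noteq> 0"
    define v where "v = multiplicity (int p) (poly f x)"
    \<comment> \<open>Beyond \<open>v\<close>, so that \<open>p ^ N\<close> divides neither
      \<open>poly f x\<close> nor the product congruent to it, and at least \<open>K\<close>, so
      that \<open>g\<close> can be reduced modulo \<open>p ^ K\<close>.\<close>
    define N where "N = K + v + 1"
    define y where "y = x - a N"
    define g where "g = eval G (padic_of_int p x) N"
    have kN: "K \<le> N" "v < N" by (simp_all add: N_def)
    have nd: "\<not> int p ^ N dvd poly f x"
      using multiplicity_geI[of "poly f x" "int p" N] kN fx pu by (auto simp: v_def)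
    have fyg: "[poly f x = y ^ ?m * g] (mod int p ^ N)"
      using G[of x N] by (simp add: y_def g_def)
    have yg: "\<not> int p ^ N dvd y ^ ?m * g"
      using nd cong_dvd_iff[OF fyg] by simp
    have "g mod int p ^ K = eval G (padic_of_int p x) K"
      using padic_ints_compat[OF eval_in_carrier[OF Gc padic_of_int_in_carrier] kN(1)]
      by (simp add: g_def)
    also have "\<dots> = eval G a K"
      using x by (intro padic_eval_entry_cong) (simp add: padic_of_int_def)
    finally have gK: "\<not> int p ^ K dvd g"
      using K by (auto simp: mod_eq_0_iff_dvd)
    have ne: "y ^ ?m * g \<noteq> 0" using yg by (metis dvd_0_right)
    have "int p ^ v dvd poly f x" by (simp add: v_def multiplicity_dvd)
    then have "int p ^ v dvd y ^ ?m * g"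
      using fyg kN by (meson cong_dvd_iff cong_dvd_modulus le_imp_power_dvd less_imp_le)
    then have "v \<le> multiplicity (int p) (y ^ ?m * g)"
      using ne pu by (intro multiplicity_geI)
    also have "\<dots> = multiplicity (int p) (y ^ ?m) + multiplicity (int p) g"
      using ne by (intro prime_elem_multiplicity_mult_distrib pe) auto
    finally have v: "v \<le> multiplicity (int p) (y ^ ?m) + multiplicity (int p) g" .
    have gm: "multiplicity (int p) g < K"
      using gK by (meson multiplicity_dvd' not_less)
    show "\<exists>j. x mod int p ^ j = a j \<and> multiplicity (int p) (poly f x) \<le> ?m * j + K"
    proof (cases "?m = 0")
      case True
      \<comment> \<open>Here \<open>y\<close> may be 0, so its valuation says nothing;
        \<open>j = 0\<close> serves, being a congruence modulo 1.\<close>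
      have "x mod int p ^ 0 = a 0"
        using padic_ints_compat[OF a, of 0 0] by simp
      moreover have "v \<le> ?m * 0 + K" using v gm True by simp
      ultimately show ?thesis unfolding v_def by blast
    next
      case False
      then have y0: "y \<noteq> 0" using ne by auto
      define j where "j = multiplicity (int p) y"
      have pj: "int p ^ j dvd y" by (simp add: j_def multiplicity_dvd)
      \<comment> \<open>The entry \<open>a j\<close> is a reduction of \<open>a N\<close> only for
        \<open>j\<close> up to \<open>N\<close>. A larger \<open>j\<close> would make
        \<open>p ^ N\<close> divide the product, since \<open>m\<close> is positive.\<close>
      have "j \<le> N"
      proof (rule ccontr)
        assume "\<not> j \<le> N"
        then have "int p ^ N dvd y" using pj by (meson dvd_trans le_imp_power_dvd nle_le)
        with False have "int p ^ N dvd y ^ ?m * g"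
          by (meson bot_nat_0.not_eq_extremum dvd_mult2 dvd_power dvd_trans)
        with yg show False ..
      qed
      then have "x mod int p ^ j = a j"
        using pj padic_ints_compat[OF a] by (metis mod_eq_dvd_iff y_def)
      moreover have "v \<le> ?m * j + K"
        using v gm y0 pe by (simp add: prime_elem_multiplicity_power_distrib j_def)
      ultimately show ?thesis unfolding v_def by blast
    qed
  qed
qed

text \<open>Compactness in the form of Koenig's lemma for the tree of residues: a bad residue has a
  bad lift, so a bad root of the tree starts an infinite bad path, which is a p-adic integer
  contradicting \<open>loc\<close>.\<close>

lemma padic_ints_compact:
  fixes good :: "nat \<Rightarrow> int \<Rightarrow> bool"
  assumes p: "p > 0"
    and step: "\<And>k r. 0 \<le> r \<Longrightarrow> r < int p ^ k \<Longrightarrow>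
      (\<And>s. s mod int p ^ k = r \<Longrightarrow> 0 \<le> s \<Longrightarrow> s < int p ^ Suc k \<Longrightarrow> good (Suc k) s) \<Longrightarrow> good k r"
    and loc: "\<And>a. a \<in> carrier (padic_ints p) \<Longrightarrow> \<exists>k. good k (a k)"
  shows "good 0 0"
proof (rule ccontr)
  assume bad: "\<not> good 0 0"
  let ?bad = "\<lambda>k r. 0 \<le> r \<and> r < int p ^ k \<and> \<not> good k r"
  have "\<exists>a. \<forall>k. ?bad k (a k) \<and> a (Suc k) mod int p ^ k = a k"
  proof (rule dependent_nat_choice)
    show "\<exists>r. ?bad 0 r" using bad by (intro exI[of _ 0]) simp
    show "\<exists>s. ?bad (Suc k) s \<and> s mod int p ^ k = r" if "?bad k r" for r k
      using that step[of r k] by blast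
  qed
  then obtain a where a: "\<And>k. ?bad k (a k)" "\<And>k. a (Suc k) mod int p ^ k = a k" by blast
  have "a m = a n mod int p ^ m" if "m \<le> n" for m n
    using that
  proof (induction n rule: dec_induct)
    case base
    then show ?case using a(1)[of m] by simp
  next
    case (step n)
    have "a (Suc n) mod int p ^ m = a (Suc n) mod int p ^ n mod int p ^ m"
      using step by (simp add: mod_mod_cancel le_imp_power_dvd)
    with step a(2)[of n] show ?case by simp
  qed
  then have "a \<in> carrier (padic_ints p)" by (auto simp: padic_ints_def)
  from loc[OF this] a(1) show False by blast
qed

text \<open>The constants of \<open>padic_valuation_near\<close> depend on the centre; compactness
  leaves finitely many of them. Balls around non-roots, where the multiplicity is 0, give the first
  alternative.\<close>

lemma padic_valuation_bound:
  assumes p: "prime p" and f: "f \<noteq> 0"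
  shows "\<exists>C. \<forall>x. poly f x \<noteq> 0 \<longrightarrow> multiplicity (int p) (poly f x) \<le> C \<or>
    (\<exists>a j. is_padic_root p f a \<and> x mod int p ^ j = a j \<and>
       multiplicity (int p) (poly f x) \<le> max_root_mult f p * j + C)"
proof -
  define bounded where "bounded C x \<longleftrightarrow> (poly f x \<noteq> 0 \<longrightarrow> multiplicity (int p) (poly f x) \<le> C \<or>
    (\<exists>a j. is_padic_root p f a \<and> x mod int p ^ j = a j \<and>
       multiplicity (int p) (poly f x) \<le> max_root_mult f p * j + C))" for C x
  have mono: "bounded D x" if "bounded C x" "C \<le> D" for C D x
    using that unfolding bounded_def by (meson add_left_mono order_trans)
  \<comment> \<open>A residue class is good if a single constant serves all its integers.\<close>
  define good where "good k r \<longleftrightarrow> (\<exists>C. \<forall>x. x mod int p ^ k = r \<longrightarrow> bounded C x)" for k r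
  have p0: "p > 0" using p by (simp add: prime_gt_0_nat)
  have "good 0 0"
  proof (rule padic_ints_compact[OF p0])
    fix k r
    assume *: "\<And>s. s mod int p ^ k = r \<Longrightarrow> 0 \<le> s \<Longrightarrow> s < int p ^ Suc k \<Longrightarrow> good (Suc k) s"
    define I where "I = {s. s mod int p ^ k = r \<and> 0 \<le> s \<and> s < int p ^ Suc k}"
    have "finite I" by (rule finite_subset[of _ "{0..<int p ^ Suc k}"]) (auto simp: I_def)
    have "\<forall>s\<in>I. \<exists>C. \<forall>x. x mod int p ^ Suc k = s \<longrightarrow> bounded C x"
      using * by (auto simp: I_def good_def)
    then obtain C where C: "\<And>s x. s \<in> I \<Longrightarrow> x mod int p ^ Suc k = s \<Longrightarrow> bounded (C s) x"
      by metis
    show "good k r"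
      unfolding good_def
    proof (intro exI allI impI)
      fix x assume x: "x mod int p ^ k = r"
      define s where "s = x mod int p ^ Suc k"
      have s: "s \<in> I"
        using x p0 mod_mod_cancel[OF le_imp_power_dvd, of k "Suc k" x "int p"]
        by (simp add: I_def s_def)
      have "bounded (C s) x" by (rule C[OF s]) (simp add: s_def)
      \<comment> \<open>The sum is a convenient common upper bound for the constants of the finitely
        many lifts.\<close>
      then show "bounded (sum C I) x"
        by (rule mono) (use s \<open>finite I\<close> in \<open>auto intro: member_le_sum\<close>)
    qed
  next
    fix a assume a: "a \<in> carrier (padic_ints p)"
    obtain K where K: "\<And>x. x mod int p ^ K = a K \<Longrightarrow> poly f x \<noteq> 0 \<Longrightarrow>
      \<exists>j. x mod int p ^ j = a j \<and> multiplicity (int p) (poly f x) \<le> padic_root_mult p f a * j + K"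
      using padic_valuation_near[OF p f a] by blast
    have "bounded K x" if x: "x mod int p ^ K = a K" for x
      unfolding bounded_def
    proof
      assume "poly f x \<noteq> 0"
      from K[OF x this] obtain j where j: "x mod int p ^ j = a j"
        "multiplicity (int p) (poly f x) \<le> padic_root_mult p f a * j + K" by blast
      show "multiplicity (int p) (poly f x) \<le> K \<or>
        (\<exists>a j. is_padic_root p f a \<and> x mod int p ^ j = a j \<and>
           multiplicity (int p) (poly f x) \<le> max_root_mult f p * j + K)"
      proof (cases "is_padic_root p f a")
        case True
        have "multiplicity (int p) (poly f x) \<le> max_root_mult f p * j + K"
          using j(2) mult_le_mono1[OF padic_root_mult_le_max[OF p True], of j] by linarith
        with True j(1) show ?thesis by blast
      next
        case False
        then have "padic_root_mult p f a = 0"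
          using domain.alg_mult_gt_zero_iff_is_root[OF domain_padic_ints[OF p]
              padic_poly_in_carrier[OF p], of f a]
          by (simp add: is_padic_root_def padic_root_mult_def)
        with j(2) show ?thesis by simp
      qed
    qed
    then show "\<exists>k. good k (a k)" by (auto simp: good_def)
  qed
  then show ?thesis by (simp add: good_def bounded_def)
qed

section \<open>Integers close to prescribed p-adic integers\<close>

locale finite_primes =
  fixes P :: "nat set"
  assumes finite_P: "finite P" and P_nonempty: "P \<noteq> {}" and prime_P: "p \<in> P \<Longrightarrow> prime p"
begin

definition modulus :: "(nat \<Rightarrow> nat) \<Rightarrow> real" where
  "modulus k = (\<Prod>p\<in>P. real p ^ k p)"

text \<open>Exponents and targets may vary with \<open>x\<close>, and the agreement may extend
  beyond \<open>k p\<close>; hence one point can be witnessed by many tuples. The sets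
  \<open>A p\<close> will consist of all roots for the upper bound and of a single root for the
  lower one.\<close>

definition close_points :: "(nat \<Rightarrow> (nat \<Rightarrow> int) set) \<Rightarrow> real \<Rightarrow> int set" where
  "close_points A T = {x. \<exists>k a. (\<forall>p\<in>P. a p \<in> A p \<and> x mod int p ^ k p = a p (k p)) \<and> T \<le> modulus k}"

lemma ge_2: "p \<in> P \<Longrightarrow> p \<ge> 2"
  by (simp add: prime_P prime_ge_2_nat)

lemma modulus_ge_1: "modulus k \<ge> 1"
  unfolding modulus_def by (rule prod_ge_1) (use ge_2 in \<open>fastforce intro!: one_le_power\<close>)

lemma modulus_remove:
  assumes "q \<in> P"
  shows "modulus k = real q ^ k q * (\<Prod>p\<in>P-{q}. real p ^ k p)"
  unfolding modulus_def using assms finite_P by (simp add: prod.remove)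

lemma modulus_upd:
  assumes "q \<in> P"
  shows "modulus (k(q := n)) = real q ^ n * (\<Prod>p\<in>P-{q}. real p ^ k p)"
  using modulus_remove[OF assms, of "k(q := n)"] by simp

lemma modulus_cong: "(\<And>p. p \<in> P \<Longrightarrow> k p = k' p) \<Longrightarrow> modulus k = modulus k'"
  unfolding modulus_def by (rule prod.cong) auto

lemma prime_power_le_modulus:
  assumes "q \<in> P"
  shows "real q ^ k q \<le> modulus k"
proof -
  have "(\<Prod>p\<in>P-{q}. real p ^ k p) \<ge> 1"
    by (rule prod_ge_1) (use ge_2 in \<open>fastforce intro!: one_le_power\<close>)
  then show ?thesis
    unfolding modulus_remove[OF assms] by (simp add: mult_le_cancel_left1)
qed

text \<open>Lower one exponent at a time. Each step divides the modulus by at most \<open>M\<close>,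
  so a modulus above \<open>T * M\<close> cannot drop below \<open>T\<close> at once.\<close>

lemma shrink_exponents:
  assumes "1 \<le> T" and "\<And>p. p \<in> P \<Longrightarrow> real p \<le> M" and "T \<le> modulus k"
  shows "\<exists>k'. (\<forall>p\<in>P. k' p \<le> k p) \<and> T \<le> modulus k' \<and> modulus k' \<le> T * M"
  using assms(3)
proof (induction "sum k P" arbitrary: k rule: less_induct)
  case less
  obtain q where "q \<in> P" using P_nonempty by blast
  then have M: "M \<ge> 1" using assms(2)[of q] ge_2[of q] by simp
  show ?case
  proof (cases "modulus k \<le> T * M")
    case True
    with less.prems show ?thesis by blast
  next
    case False
    moreover have "T * M \<ge> 1" using assms(1) M mult_mono[of 1 T 1 M] by simp
    ultimately have "modulus k \<noteq> 1" by simp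
    moreover have "modulus k = 1" if "\<forall>p\<in>P. k p = 0" using that by (simp add: modulus_def)
    ultimately obtain p where p: "p \<in> P" "k p \<noteq> 0" by blast
    define k1 where "k1 = k(p := k p - 1)"
    have eq: "modulus k = real p * modulus k1"
      using p by (simp add: k1_def modulus_upd modulus_remove[of p k] power_eq_if)
    have "T * real p \<le> T * M" using assms(1,2) p by (intro mult_left_mono) auto
    then have "real p * T \<le> real p * modulus k1" using False eq by (simp add: mult.commute)
    then have T: "T \<le> modulus k1" using ge_2[OF p(1)] by simp
    have "sum k1 P < sum k P"
    proof (rule sum_strict_mono_ex1[OF finite_P])
      show "\<forall>q\<in>P. k1 q \<le> k q" by (simp add: k1_def)
      have "k1 p < k p" using p by (simp add: k1_def)
      with p show "\<exists>q\<in>P. k1 q < k q" by blast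
    qed
    from less.hyps[OF this T] obtain k' where
      k': "\<forall>p\<in>P. k' p \<le> k1 p" "T \<le> modulus k'" "modulus k' \<le> T * M" by blast
    have "\<forall>q\<in>P. k' q \<le> k q"
    proof
      fix q assume "q \<in> P"
      then show "k' q \<le> k q" using k'(1) by (force simp: k1_def split: if_splits)
    qed
    with k' show ?thesis by blast
  qed
qed

definition exponents_between :: "real \<Rightarrow> real \<Rightarrow> (nat \<Rightarrow> nat) set" where
  "exponents_between T U = {k \<in> PiE P (\<lambda>_. UNIV). T \<le> modulus k \<and> modulus k \<le> U}"

text \<open>All primes are at least 2, so no exponent exceeds \<open>L\<close>. One of them costs
  only the factor \<open>D\<close>, which does not grow with \<open>T\<close>; this is why the
  logarithm gets the power \<open>card P - 1\<close>.\<close>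

lemma card_exponents_between:
  assumes T: "0 < T" and L: "T * M \<le> 2 ^ L" and D: "M < 2 ^ D" "0 < D"
  shows "finite (exponents_between T (T * M))"
    and "card (exponents_between T (T * M)) \<le> (L + 1) ^ (card P - 1) * D"
proof -
  obtain q where q: "q \<in> P" using P_nonempty by blast
  let ?K = "exponents_between T (T * M)"
  let ?I = "PiE (P - {q}) (\<lambda>_. {..L}) \<times> {..<D}"
  \<comment> \<open>Once the other exponents are fixed, those of \<open>q\<close> differ by less than \<open>D\<close>,
    so their residues modulo \<open>D\<close> determine them.\<close>
  define \<phi> where "\<phi> k = (restrict k (P - {q}), k q mod D)" for k :: "nat \<Rightarrow> nat"
  have fin: "finite ?I" using finite_P by (auto intro!: finite_PiE)
  have le: "k p \<le> L" if "k \<in> ?K" "p \<in> P" for k p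
  proof -
    have "2 ^ k p \<le> real p ^ k p" using ge_2[OF that(2)] by (intro power_mono) auto
    also have "\<dots> \<le> modulus k" by (rule prime_power_le_modulus[OF that(2)])
    also have "\<dots> \<le> 2 ^ L" using that(1) L by (simp add: exponents_between_def)
    finally show ?thesis by simp
  qed
  have sub: "\<phi> ` ?K \<subseteq> ?I" using le D(2) by (auto simp: \<phi>_def split: if_splits)
  have aux: "k' q - k q < D"
    if k: "k \<in> ?K" "k' \<in> ?K" and r: "restrict k (P - {q}) = restrict k' (P - {q})"
      and "k q \<le> k' q" for k k'
  proof -
    let ?W = "\<Prod>p\<in>P-{q}. real p ^ k p"
    have W': "(\<Prod>p\<in>P-{q}. real p ^ k' p) = ?W"
    proof (rule prod.cong[OF refl])
      fix p assume "p \<in> P - {q}"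
      with fun_cong[OF r, of p] show "real p ^ k' p = real p ^ k p" by simp
    qed
    have W: "?W > 0" by (rule prod_pos) (use ge_2 in fastforce)
    have q0: "real q ^ k q > 0" using ge_2[OF q] by simp
    have "T \<le> modulus k" "modulus k \<le> T * M"
      using k(1) by (simp_all add: exponents_between_def)
    then have "0 < T * M" using T by linarith
    then have "M > 0" using T by (rule zero_less_mult_pos)
    have "real q ^ (k' q - k q) * (real q ^ k q * ?W) = modulus k'"
      using \<open>k q \<le> k' q\<close> by (simp add: modulus_remove[OF q] W' flip: power_add)
    also have "\<dots> \<le> T * M" using k(2) by (simp add: exponents_between_def)
    also have "\<dots> \<le> modulus k * M"
      using k(1) \<open>M > 0\<close> by (simp add: exponents_between_def)
    also have "\<dots> = M * (real q ^ k q * ?W)" by (simp add: modulus_remove[OF q])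
    finally have "real q ^ (k' q - k q) \<le> M" using W q0 by simp
    moreover have "2 ^ (k' q - k q) \<le> real q ^ (k' q - k q)"
      using ge_2[OF q] by (intro power_mono) auto
    ultimately have "(2::real) ^ (k' q - k q) < 2 ^ D" using D(1) by linarith
    then show ?thesis by simp
  qed
  have mod_eq: "m = n" if "m mod D = n mod D" "m \<le> n" "n - m < D" for m n :: nat
    using that by (metis diff_is_0_eq dvd_imp_le le_antisym mod_eq_dvd_iff_nat not_less
        bot_nat_0.not_eq_extremum)
  have inj: "inj_on \<phi> ?K"
  proof (rule inj_onI)
    fix k k' assume k: "k \<in> ?K" "k' \<in> ?K" and "\<phi> k = \<phi> k'"
    then have r: "restrict k (P - {q}) = restrict k' (P - {q})" and m: "k q mod D = k' q mod D"
      by (auto simp: \<phi>_def)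
    have eq: "k q = k' q"
    proof (cases "k q \<le> k' q")
      case True
      with mod_eq[OF m] aux[OF k r] show ?thesis by simp
    next
      case False
      with mod_eq[OF m[symmetric]] aux[OF k(2,1) r[symmetric]] show ?thesis by simp
    qed
    show "k = k'"
    proof
      fix p
      show "k p = k' p"
      proof (cases "p \<in> P - {q}")
        case True
        with fun_cong[OF r, of p] show ?thesis by simp
      next
        case False
        with k eq show ?thesis by (auto simp: exponents_between_def PiE_def extensional_def)
      qed
    qed
  qed
  show "finite ?K" using inj sub fin by (meson finite_imageD finite_subset)
  have "card ?K = card (\<phi> ` ?K)" by (rule card_image[OF inj, symmetric])
  also have "\<dots> \<le> card ?I" by (rule card_mono[OF fin sub])
  also have "\<dots> = (L + 1) ^ (card P - 1) * D"
    using finite_P q by (simp add: card_cartesian_product card_PiE)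
  finally show "card ?K \<le> (L + 1) ^ (card P - 1) * D" .
qed

section \<open>Upper bound: covering by residue classes\<close>

lemma coprime_prime_powers:
  assumes "p \<in> P" "q \<in> P" "p \<noteq> q"
  shows "coprime (p ^ m) (q ^ n)"
  using assms by (simp add: prime_P primes_coprime)

text \<open>Coprimality fixes \<open>x\<close> modulo the product \<open>m\<close>, so members of
  the class have distinct quotients \<open>x div m\<close>, and these lie between the floors of
  \<open>- Y / m\<close> and \<open>Y / m\<close>.\<close>

lemma card_residue_class:
  assumes Y: "0 \<le> Y"
  shows "real (card {x. \<bar>real_of_int x\<bar> \<le> Y \<and> (\<forall>p\<in>P. x mod int p ^ k p = b p)}) \<le> 2 * Y / modulus k + 2"
    (is "real (card ?S) \<le> _")
proof -
  define m :: int where "m = (\<Prod>p\<in>P. int p ^ k p)"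
  have m: "real_of_int m = modulus k" by (simp add: m_def modulus_def)
  have m0: "m > 0" using m modulus_ge_1[of k] by linarith
  let ?I = "{\<lfloor>- Y / m\<rfloor> .. \<lfloor>Y / m\<rfloor>}"
  have "(\<lambda>x. x div m) ` ?S \<subseteq> ?I"
  proof
    fix y assume "y \<in> (\<lambda>x. x div m) ` ?S"
    then obtain x where x: "\<bar>real_of_int x\<bar> \<le> Y" "y = x div m" by blast
    have "y = \<lfloor>real_of_int x / real_of_int m\<rfloor>" by (simp add: x(2) floor_divide_of_int_eq)
    moreover have "- Y \<le> x" "x \<le> Y" using x(1) by linarith+
    ultimately show "y \<in> ?I"
      using m0 floor_mono[OF divide_right_mono[of "- Y" x m]] floor_mono[OF divide_right_mono[of x Y m]]
      by simp
  qed
  moreover have inj: "inj_on (\<lambda>x. x div m) ?S"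
  proof (rule inj_onI)
    fix x y assume x: "x \<in> ?S" and y: "y \<in> ?S" and eq: "x div m = y div m"
    have "[x = y] (mod m)"
      unfolding m_def
    proof (rule cong_cong_prod_coprime; intro ballI impI)
      show "coprime (int p ^ k p) (int q ^ k q)" if "p \<in> P" "q \<in> P" "p \<noteq> q" for p q
        using coprime_prime_powers[OF that, of "k p" "k q"] by (metis coprime_int_iff of_nat_power)
      show "[x = y] (mod int p ^ k p)" if "p \<in> P" for p
        using x y that by (simp add: Cong.cong_def)
    qed
    with eq show "x = y" by (metis Cong.cong_def mod_div_mult_eq)
  qed
  ultimately have "card ?S \<le> card ?I"
    by (intro card_inj_on_le) auto
  moreover have "real (card ?I) \<le> 2 * Y / m + 2"
  proof -
    have "- Y / m \<le> Y / m" using Y m0 by (simp add: field_simps)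
    then have "\<lfloor>- Y / m\<rfloor> \<le> \<lfloor>Y / m\<rfloor>" by (rule floor_mono)
    then have "real (card ?I) = \<lfloor>Y / m\<rfloor> - \<lfloor>- Y / m\<rfloor> + 1" by simp
    moreover have "\<lfloor>Y / m\<rfloor> \<le> Y / m" "\<lfloor>- Y / m\<rfloor> > - Y / m - 1" by linarith+
    moreover have "2 * Y / m = 2 * (Y / m)" "- Y / m = - (Y / m)" by simp_all
    ultimately show ?thesis by linarith
  qed
  ultimately show ?thesis unfolding m[symmetric] by linarith
qed

lemma finite_ints_abs_le: "finite {x :: int. \<bar>real_of_int x\<bar> \<le> Y}"
proof (rule finite_subset)
  show "{x :: int. \<bar>real_of_int x\<bar> \<le> Y} \<subseteq> {-\<lceil>Y\<rceil>..\<lceil>Y\<rceil>}"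
    by (auto; linarith)
qed simp

text \<open>After shrinking, every point lies in a class whose modulus is between \<open>T\<close>
  and \<open>T * M\<close>. The bound is the number of such classes times the size of one.\<close>

lemma card_close_points_shell:
  assumes fin: "\<And>p. p \<in> P \<Longrightarrow> finite (A p)"
    and compat: "\<And>p a m n. p \<in> P \<Longrightarrow> a \<in> A p \<Longrightarrow> m \<le> n \<Longrightarrow> a n mod int p ^ m = a m"
    and Y: "0 \<le> Y" and T: "1 \<le> T"
    and M: "\<And>p. p \<in> P \<Longrightarrow> real p \<le> M" and L: "T * M \<le> 2 ^ L" and D: "M < 2 ^ D"
  shows "real (card {x \<in> close_points A T. \<bar>real_of_int x\<bar> \<le> Y})
    \<le> real ((L + 1) ^ (card P - 1) * D * (\<Prod>p\<in>P. card (A p))) * (2 * Y / T + 2)"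
proof -
  let ?W = "{x \<in> close_points A T. \<bar>real_of_int x\<bar> \<le> Y}"
  let ?K = "exponents_between T (T * M)"
  let ?J = "?K \<times> PiE P A"
  define cls where "cls = (\<lambda>(k, a). {x. \<bar>real_of_int x\<bar> \<le> Y \<and> (\<forall>p\<in>P. x mod int p ^ k p = a p (k p))})"
  obtain q where q: "q \<in> P" using P_nonempty by blast
  have "D > 0" using D M[OF q] ge_2[OF q] by (cases D) auto
  note K = card_exponents_between[OF less_le_trans[OF zero_less_one T] L D this]
  have finJ: "finite ?J" using K(1) finite_P fin by (auto intro!: finite_PiE)
  have fincls: "finite (cls i)" for i
    by (rule finite_subset[OF _ finite_ints_abs_le[of Y]]) (auto simp: cls_def split: prod.splits)
  have "?W \<subseteq> (\<Union>i\<in>?J. cls i)"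
  proof
    fix x assume x: "x \<in> ?W"
    then obtain k a where k: "\<And>p. p \<in> P \<Longrightarrow> a p \<in> A p" "\<And>p. p \<in> P \<Longrightarrow> x mod int p ^ k p = a p (k p)"
      "T \<le> modulus k" by (auto simp: close_points_def)
    obtain k' where k': "\<And>p. p \<in> P \<Longrightarrow> k' p \<le> k p" "T \<le> modulus k'" "modulus k' \<le> T * M"
      using shrink_exponents[OF T M k(3)] by blast
    have "x mod int p ^ k' p = a p (k' p)" if p: "p \<in> P" for p
    proof -
      have "x mod int p ^ k' p = x mod int p ^ k p mod int p ^ k' p"
        using k'(1)[OF p] by (simp add: mod_mod_cancel le_imp_power_dvd)
      then show ?thesis using k(1,2)[OF p] compat[OF p _ k'(1)[OF p]] by simp
    qed
    then have "x \<in> cls (restrict k' P, restrict a P)"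
      using x by (simp add: cls_def)
    moreover have "modulus (restrict k' P) = modulus k'" by (rule modulus_cong) simp
    then have "(restrict k' P, restrict a P) \<in> ?J"
      using k(1) k' by (auto simp: exponents_between_def)
    ultimately show "x \<in> (\<Union>i\<in>?J. cls i)" by blast
  qed
  then have "card ?W \<le> card (\<Union>i\<in>?J. cls i)"
    using finJ fincls by (intro card_mono) auto
  also have "\<dots> \<le> (\<Sum>i\<in>?J. card (cls i))" by (rule card_UN_le[OF finJ])
  finally have "real (card ?W) \<le> (\<Sum>i\<in>?J. real (card (cls i)))"
    by (metis (mono_tags) of_nat_mono of_nat_sum)
  also have "\<dots> \<le> of_nat (card ?J) * (2 * Y / T + 2)"
  proof (rule sum_bounded_above)
    fix i assume "i \<in> ?J"
    then obtain k a where i: "i = (k, a)" and k: "T \<le> modulus k"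
      by (auto simp: exponents_between_def)
    have "real (card (cls i)) \<le> 2 * Y / modulus k + 2"
      unfolding i cls_def prod.case by (rule card_residue_class[OF Y])
    also have "2 * Y / modulus k \<le> 2 * Y / T"
      using k T Y by (intro divide_left_mono mult_pos_pos) auto
    finally show "real (card (cls i)) \<le> 2 * Y / T + 2" by simp
  qed
  also have "card ?J = card ?K * (\<Prod>p\<in>P. card (A p))"
    using finite_P by (simp add: card_cartesian_product card_PiE)
  also have "real \<dots> * (2 * Y / T + 2)
      \<le> real ((L + 1) ^ (card P - 1) * D * (\<Prod>p\<in>P. card (A p))) * (2 * Y / T + 2)"
    using K(2) Y T by (intro mult_right_mono of_nat_mono mult_le_mono) auto
  finally show ?thesis .
qed

text \<open>The threshold depends on \<open>x\<close>, so the points are split by the dyadic size of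
  \<open>x\<close>, on which it is constant up to a factor. The resulting geometric series has ratio
  \<open>\<beta> > 1\<close> and is dominated by its last term.\<close>

lemma card_close_points_le:
  assumes fin: "\<And>p. p \<in> P \<Longrightarrow> finite (A p)"
    and compat: "\<And>p a m n. p \<in> P \<Longrightarrow> a \<in> A p \<Longrightarrow> m \<le> n \<Longrightarrow> a n mod int p ^ m = a m"
    and \<alpha>: "0 < \<alpha>" "\<alpha> < 1" and c: "c > 0"
  shows "\<exists>C>0. \<forall>B\<ge>2. real (card {x. \<bar>real_of_int x\<bar> \<le> B \<and> x \<in> close_points A (c * \<bar>real_of_int x\<bar> powr \<alpha>)})
    \<le> C * (B powr (1 - \<alpha>) * ln B ^ (card P - 1))"
proof -
  define M where "M = real (Max P)"
  have M: "real p \<le> M" if "p \<in> P" for p using that finite_P by (simp add: M_def)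
  obtain q where "q \<in> P" using P_nonempty by blast
  then have M0: "M \<ge> 1" using M[of q] ge_2[of q] by simp
  obtain D where D: "M < 2 ^ D" using real_arch_pow[of 2 M] by auto
  define c' where "c' = max 1 c"
  \<comment> \<open>With this \<open>E\<close>, \<open>T j * M\<close> is at most
    \<open>2 ^ (j + E)\<close>: since \<open>\<alpha> < 1\<close>, the threshold \<open>T j\<close>
    is at most \<open>c' * 2 ^ j\<close>.\<close>
  obtain E where E: "c' * M < 2 ^ E" using real_arch_pow[of 2 "c' * M"] by auto
  define s where "s = card P - 1"
  define \<beta> :: real where "\<beta> = 2 powr (1 - \<alpha>)"
  have \<beta>: "\<beta> > 1" using \<alpha> by (simp add: \<beta>_def)
  have \<beta>_power: "\<beta> ^ j = 2 powr ((1 - \<alpha>) * real j)" for j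
    unfolding \<beta>_def by (simp add: powr_powr flip: powr_realpow)
  \<comment> \<open>The term \<open>4 / c\<close> comes from \<open>2 * 2 ^ (j + 1) / T j\<close>;
    the 2 is the additive error per class, absorbed because \<open>\<beta> ^ j\<close> is at least
    1.\<close>
  define F where "F = real (D * (\<Prod>p\<in>P. card (A p))) * (4 / c + 2)"
  have F: "F \<ge> 0" unfolding F_def using c by (intro mult_nonneg_nonneg of_nat_0_le_iff) auto
  \<comment> \<open>Raising the threshold to 1 loses no points, as every modulus is at least 1, and
    meets the hypothesis of the shell estimate.\<close>
  define T where "T j = max 1 (c * 2 powr (\<alpha> * real j))" for j :: nat
  define W where "W j = {x \<in> close_points A (T j). \<bar>real_of_int x\<bar> \<le> 2 ^ (j + 1)}" for j
  have finW: "finite (W j)" for j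
    by (rule finite_subset[OF _ finite_ints_abs_le[of "2 ^ (j + 1)"]]) (auto simp: W_def)
  have W: "real (card (W j)) \<le> real (j + E + 1) ^ s * (F * \<beta> ^ j)" for j
  proof -
    have \<beta>1: "\<beta> ^ j \<ge> 1" using \<beta> by simp
    have "T j \<le> c' * 2 ^ j"
    proof -
      have "2 powr (\<alpha> * real j) \<le> 2 powr real j"
        using \<alpha> by (intro powr_mono mult_left_le_one_le) auto
      also have "\<dots> = 2 ^ j" by (simp add: powr_realpow)
      finally have "c * 2 powr (\<alpha> * real j) \<le> c' * 2 ^ j" using c by (intro mult_mono) (auto simp: c'_def)
      moreover have "1 * 1 \<le> c' * 2 ^ j" by (intro mult_mono) (auto simp: c'_def)
      ultimately show ?thesis by (simp add: T_def)
    qed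
    then have "T j * M \<le> c' * 2 ^ j * M" using M0 by (intro mult_right_mono) auto
    also have "\<dots> \<le> 2 ^ (j + E)" using E by (simp add: power_add)
    finally have TM: "T j * M \<le> 2 ^ (j + E)" .
    have "real (card (W j)) \<le> real ((j + E + 1) ^ s * D * (\<Prod>p\<in>P. card (A p))) * (2 * 2 ^ (j + 1) / T j + 2)"
      unfolding W_def s_def
      by (rule card_close_points_shell[OF fin compat _ _ M TM D]) (auto simp: T_def)
    also have "\<dots> \<le> real ((j + E + 1) ^ s * D * (\<Prod>p\<in>P. card (A p))) * ((4 / c + 2) * \<beta> ^ j)"
    proof (rule mult_left_mono)
      have "2 * 2 ^ (j + 1) / T j \<le> 2 * 2 ^ (j + 1) / (c * 2 powr (\<alpha> * real j))"
        using c by (intro divide_left_mono mult_pos_pos) (auto simp: T_def)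
      also have "\<dots> = 4 / c * (2 powr real j / 2 powr (\<alpha> * real j))"
        by (simp add: powr_realpow)
      also have "\<dots> = 4 / c * \<beta> ^ j"
        unfolding \<beta>_power by (simp add: powr_diff[symmetric] algebra_simps)
      finally show "2 * 2 ^ (j + 1) / T j + 2 \<le> (4 / c + 2) * \<beta> ^ j"
        using \<beta>1 by (simp add: algebra_simps)
    qed (rule of_nat_0_le_iff)
    finally show ?thesis by (simp add: F_def mult_ac)
  qed
  \<comment> \<open>For \<open>B\<close> at least 2 the logarithm to base 2 is at least 1, hence
    \<open>J + E + 1\<close> is at most \<open>(E + 2) * log 2 B = K * ln B\<close>.\<close>
  define K where "K = (real E + 2) / ln 2"
  have K: "K > 0" by (simp add: K_def)
  define C where "C = K ^ s * (1 + F * \<beta> / (\<beta> - 1))"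
  have "C > 0" using K F \<beta> by (auto simp: C_def intro!: mult_pos_pos add_pos_nonneg)
  moreover have "real (card {x. \<bar>real_of_int x\<bar> \<le> B \<and> x \<in> close_points A (c * \<bar>real_of_int x\<bar> powr \<alpha>)})
    \<le> C * (B powr (1 - \<alpha>) * ln B ^ s)" (is "real (card ?V) \<le> _") if B: "B \<ge> 2" for B
  proof -
    define J where "J = nat \<lfloor>log 2 B\<rfloor>"
    have "log 2 B \<ge> 1" using B by simp
    then have J: "real J \<le> log 2 B" "log 2 B < real J + 1"
      unfolding J_def by linarith+
    have J': "2 ^ J \<le> B" "B < 2 ^ (J + 1)"
      using J B by (simp_all add: le_log_iff log_less_iff powr_realpow powr_add)
    \<comment> \<open>The point 0 lies in no dyadic range; it accounts for the summand 1 in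
      \<open>C\<close>.\<close>
    have "?V \<subseteq> insert 0 (\<Union>j\<le>J. W j)"
    proof
      fix x assume x: "x \<in> ?V"
      show "x \<in> insert 0 (\<Union>j\<le>J. W j)"
      proof (cases "x = 0")
        case False
        define y where "y = \<bar>real_of_int x\<bar>"
        have y: "y \<ge> 1" "y \<le> B" using False x by (auto simp: y_def)
        define j where "j = nat \<lfloor>log 2 y\<rfloor>"
        have "log 2 y \<ge> 0" using y by simp
        then have j: "real j \<le> log 2 y" "log 2 y < real j + 1"
          unfolding j_def by linarith+
        then have j': "2 powr real j \<le> y" "y < 2 ^ (j + 1)"
          using y by (simp_all add: le_log_iff log_less_iff powr_realpow powr_add)
        have "log 2 y \<le> log 2 B" using y by simp
        then have "j \<le> J" unfolding j_def J_def by (intro nat_mono floor_mono)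
        have "2 powr (\<alpha> * real j) \<le> y powr \<alpha>"
          using j'(1) \<alpha> powr_mono2[of \<alpha> "2 powr real j" y] by (simp add: powr_powr mult.commute)
        then have "c * 2 powr (\<alpha> * real j) \<le> c * y powr \<alpha>" using c by simp
        moreover obtain k a where ka: "\<forall>p\<in>P. a p \<in> A p \<and> x mod int p ^ k p = a p (k p)"
          "c * y powr \<alpha> \<le> modulus k"
          using x by (auto simp: close_points_def y_def)
        ultimately have "T j \<le> modulus k" using modulus_ge_1[of k] by (simp add: T_def)
        with ka(1) have "x \<in> close_points A (T j)" unfolding close_points_def by blast
        with j'(2) \<open>j \<le> J\<close> show ?thesis by (auto simp: W_def y_def)
      qed simp
    qed
    then have "card ?V \<le> card (insert 0 (\<Union>j\<le>J. W j))"
      using finW by (intro card_mono) auto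
    also have "\<dots> \<le> 1 + card (\<Union>j\<le>J. W j)" using finW by (simp add: card_insert_if)
    also have "\<dots> \<le> 1 + (\<Sum>j\<le>J. card (W j))" by (intro add_left_mono card_UN_le) simp
    finally have "real (card ?V) \<le> 1 + (\<Sum>j\<le>J. real (card (W j)))"
      by (metis (mono_tags) of_nat_mono of_nat_sum of_nat_add of_nat_1)
    also have "(\<Sum>j\<le>J. real (card (W j))) \<le> (\<Sum>j\<le>J. real (J + E + 1) ^ s * (F * \<beta> ^ j))"
    proof (rule sum_mono)
      fix j assume "j \<in> {..J}"
      then have "real (j + E + 1) ^ s * (F * \<beta> ^ j) \<le> real (J + E + 1) ^ s * (F * \<beta> ^ j)"
        using F \<beta> by (intro mult_right_mono power_mono) auto
      with W[of j] show "real (card (W j)) \<le> real (J + E + 1) ^ s * (F * \<beta> ^ j)" by linarith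
    qed
    also have "\<dots> = real (J + E + 1) ^ s * (F * (\<Sum>j\<le>J. \<beta> ^ j))"
      by (simp add: sum_distrib_left)
    also have "\<dots> \<le> (K * ln B) ^ s * (F * (\<beta> / (\<beta> - 1) * B powr (1 - \<alpha>)))"
    proof (intro mult_mono power_mono mult_left_mono)
      have "real (J + E + 1) = real J + (real E + 1) * 1" by simp
      also have "\<dots> \<le> log 2 B + (real E + 1) * log 2 B"
        using J(1) \<open>log 2 B \<ge> 1\<close> by (intro add_mono mult_left_mono) auto
      also have "\<dots> = K * ln B" by (simp add: K_def log_def field_simps)
      finally show "real (J + E + 1) \<le> K * ln B" .
      have "(\<Sum>j\<le>J. \<beta> ^ j) = (\<beta> ^ Suc J - 1) / (\<beta> - 1)"
        using \<beta> geometric_sum[of \<beta> "Suc J"] by (simp add: lessThan_Suc_atMost)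
      also have "\<dots> \<le> \<beta> ^ Suc J / (\<beta> - 1)" using \<beta> by (intro divide_right_mono) auto
      also have "\<dots> = \<beta> / (\<beta> - 1) * \<beta> ^ J" by simp
      also have "\<dots> \<le> \<beta> / (\<beta> - 1) * B powr (1 - \<alpha>)"
      proof (rule mult_left_mono)
        have "\<beta> ^ J = (2 ^ J) powr (1 - \<alpha>)"
          unfolding \<beta>_power by (simp add: powr_powr mult.commute flip: powr_realpow)
        also have "\<dots> \<le> B powr (1 - \<alpha>)" using J'(1) \<alpha> by (intro powr_mono2) auto
        finally show "\<beta> ^ J \<le> B powr (1 - \<alpha>)" .
      qed (use \<beta> in simp)
      finally show "(\<Sum>j\<le>J. \<beta> ^ j) \<le> \<beta> / (\<beta> - 1) * B powr (1 - \<alpha>)" .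
    qed (use K B F \<beta> in \<open>auto intro!: mult_nonneg_nonneg sum_nonneg\<close>)
    also have "1 + (K * ln B) ^ s * (F * (\<beta> / (\<beta> - 1) * B powr (1 - \<alpha>)))
      \<le> (K * ln B) ^ s * B powr (1 - \<alpha>) + (K * ln B) ^ s * (F * (\<beta> / (\<beta> - 1) * B powr (1 - \<alpha>)))"
    proof (intro add_right_mono)
      have "1 \<le> log 2 B" by fact
      also have "log 2 B \<le> K * ln B" using B by (simp add: K_def log_def field_simps)
      finally have "1 \<le> (K * ln B) ^ s" by simp
      moreover have "1 \<le> B powr (1 - \<alpha>)" using B \<alpha> by (intro ge_one_powr_ge_zero) auto
      ultimately show "1 \<le> (K * ln B) ^ s * B powr (1 - \<alpha>)"
        using mult_mono[of 1 "(K * ln B) ^ s" 1 "B powr (1 - \<alpha>)"] by simp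
    qed
    also have "\<dots> = C * (B powr (1 - \<alpha>) * ln B ^ s)"
      by (simp add: C_def power_mult_distrib algebra_simps)
    finally show ?thesis by simp
  qed
  ultimately show ?thesis unfolding s_def by blast
qed

section \<open>Lower bound: disjoint families of points\<close>

definition exact_points :: "(nat \<Rightarrow> nat \<Rightarrow> int) \<Rightarrow> (nat \<Rightarrow> nat) \<Rightarrow> int set" where
  "exact_points a k =
    {x. \<forall>p\<in>P. x mod int p ^ k p = a p (k p) \<and> x mod int p ^ Suc (k p) \<noteq> a p (Suc (k p))}"

text \<open>The failing congruence modulo \<open>p ^ Suc (k p)\<close> makes \<open>k p\<close> the
  exact order of agreement with \<open>a p\<close>. Counts over tuples that differ on
  \<open>P\<close> therefore add up.\<close>

lemma exact_points_disjoint: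
  assumes compat: "\<And>p m n. p \<in> P \<Longrightarrow> m \<le> n \<Longrightarrow> a p n mod int p ^ m = a p m"
    and x: "x \<in> exact_points a k" "x \<in> exact_points a k'" and p: "p \<in> P"
  shows "k p = k' p"
proof -
  have "\<not> k p < k' p" if "x \<in> exact_points a k" "x \<in> exact_points a k'" for k k'
  proof
    assume less: "k p < k' p"
    then have "x mod int p ^ Suc (k p) = x mod int p ^ k' p mod int p ^ Suc (k p)"
      by (simp add: mod_mod_cancel le_imp_power_dvd del: power_Suc)
    also have "\<dots> = a p (Suc (k p))"
      using that(2) p compat[OF p, of "Suc (k p)" "k' p"] less by (simp add: exact_points_def)
    finally show False using that(1) p by (simp add: exact_points_def)
  qed
  from this[OF x] this[OF x(2,1)] show ?thesis by simp
qed

text \<open>By the Chinese remainder theorem some full residue class modulo \<open>N\<close>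
  consists of exact points; its non-negative members up to \<open>Y\<close> suffice.\<close>

lemma card_exact_points_ge:
  assumes compat: "\<And>p m n. p \<in> P \<Longrightarrow> m \<le> n \<Longrightarrow> a p n mod int p ^ m = a p m"
    and Y: "0 \<le> Y"
  shows "Y / (modulus k * real (\<Prod>P)) - 1 \<le> real (card {x \<in> exact_points a k. \<bar>real_of_int x\<bar> \<le> Y})"
    (is "_ \<le> real (card ?S)")
proof -
  define N where "N = (\<Prod>p\<in>P. p ^ Suc (k p))"
  have N: "real N = modulus k * real (\<Prod>P)"
    by (simp add: N_def modulus_def prod.distrib mult.commute)
  have N0: "N > 0" unfolding N_def by (rule prod_pos) (use ge_2 in fastforce)
  \<comment> \<open>Adding \<open>p ^ k p\<close> keeps the residue modulo \<open>p ^ k p\<close>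
    and changes it modulo \<open>p ^ Suc (k p)\<close>.\<close>
  define u where "u p = nat ((a p (Suc (k p)) + int p ^ k p) mod int p ^ Suc (k p))" for p
  have u: "int (u p) = (a p (Suc (k p)) + int p ^ k p) mod int p ^ Suc (k p)" if "p \<in> P" for p
    using ge_2[OF that] unfolding u_def by (intro nat_0_le pos_mod_sign) auto
  have "\<exists>y. \<forall>p\<in>P. [y = u p] (mod p ^ Suc (k p))"
    by (rule chinese_remainder_nat[OF finite_P]) (use coprime_prime_powers in blast)
  then obtain y where y: "\<And>p. p \<in> P \<Longrightarrow> [y = u p] (mod p ^ Suc (k p))" by blast
  \<comment> \<open>The \<open>j\<close>-th member of the class lies below \<open>Suc j * N\<close>,
    so the indices below \<open>J\<close> stay within \<open>Y\<close>.\<close>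
  define g where "g j = int (y mod N + j * N)" for j
  have g_exact: "g j \<in> exact_points a k" for j
    unfolding exact_points_def
  proof (rule CollectI, rule ballI)
    fix p assume p: "p \<in> P"
    let ?q = "int p ^ Suc (k p)"
    have "p ^ Suc (k p) dvd N" unfolding N_def by (rule dvd_prodI[OF finite_P p])
    moreover have "[y mod N + j * N = y] (mod N)" unfolding Cong.cong_def by simp
    ultimately have "[y mod N + j * N = y] (mod p ^ Suc (k p))"
      by (rule cong_dvd_modulus_nat[rotated])
    then have "[y mod N + j * N = u p] (mod p ^ Suc (k p))" using y[OF p] by (rule cong_trans)
    then have "[g j = int (u p)] (mod ?q)"
      unfolding g_def by (metis cong_int_iff of_nat_power)
    then have g: "[g j = a p (Suc (k p)) + int p ^ k p] (mod ?q)"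
      using u[OF p] by (simp add: Cong.cong_def)
    have "g j mod int p ^ k p = (a p (Suc (k p)) + int p ^ k p) mod int p ^ k p"
      using cong_dvd_modulus[OF g, of "int p ^ k p"] unfolding Cong.cong_def by simp
    also have "\<dots> = a p (k p)" using compat[OF p, of "k p" "Suc (k p)"] by simp
    finally have 1: "g j mod int p ^ k p = a p (k p)" .
    have 2: "g j mod ?q \<noteq> a p (Suc (k p))"
    proof
      assume "g j mod ?q = a p (Suc (k p))"
      then have "g j mod ?q = a p (Suc (k p)) mod ?q" using compat[OF p order_refl, of "Suc (k p)"] by simp
      then have "?q dvd g j - a p (Suc (k p))" by (simp only: mod_eq_dvd_iff)
      moreover have "?q dvd g j - (a p (Suc (k p)) + int p ^ k p)"
        using g by (simp only: cong_iff_dvd_diff)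
      ultimately have "?q dvd (g j - a p (Suc (k p))) - (g j - (a p (Suc (k p)) + int p ^ k p))"
        by (rule dvd_diff)
      then have "?q dvd int p ^ k p" by simp
      then have "int p dvd 1" using ge_2[OF p] by simp
      then show False using ge_2[OF p] by simp
    qed
    show "g j mod int p ^ k p = a p (k p) \<and> g j mod ?q \<noteq> a p (Suc (k p))" using 1 2 by blast
  qed
  define J where "J = nat \<lfloor>Y / real N\<rfloor>"
  have J: "real J \<le> Y / real N" using Y by (simp add: J_def)
  have "g ` {..<J} \<subseteq> ?S"
  proof
    fix x assume "x \<in> g ` {..<J}"
    then obtain j where j: "j < J" "x = g j" by blast
    have "y mod N + j * N \<le> Suc j * N" using N0 by (simp add: less_imp_le)
    also have "\<dots> \<le> J * N" using j by (intro mult_le_mono1) simp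
    finally have "real (y mod N + j * N) \<le> real J * real N" by (metis of_nat_mono of_nat_mult)
    also have "\<dots> \<le> Y" using J N0 by (simp add: field_simps)
    finally show "x \<in> ?S" using g_exact j by (simp add: g_def)
  qed
  moreover have "finite ?S" by (rule finite_subset[OF _ finite_ints_abs_le[of Y]]) auto
  ultimately have "card (g ` {..<J}) \<le> card ?S" by (intro card_mono)
  moreover have "card (g ` {..<J}) = J"
    using N0 by (subst card_image) (auto simp: inj_on_def g_def)
  ultimately have "real J \<le> real (card ?S)" by simp
  moreover have "Y / real N - 1 \<le> real J" unfolding J_def by linarith
  ultimately show ?thesis unfolding N by linarith
qed

text \<open>Take the least \<open>n\<close> that reaches \<open>T\<close>. One power of
  \<open>q\<close> less falls short, so the overshoot is at most \<open>q\<close>; for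
  \<open>n = 0\<close> the bound comes from the assumption on the other primes.\<close>

lemma exponent_completing:
  assumes q: "q \<in> P" and W: "(\<Prod>p\<in>P-{q}. real p ^ h p) \<le> T"
  shows "\<exists>n. T \<le> modulus (h(q := n)) \<and> modulus (h(q := n)) \<le> T * real q"
proof -
  let ?W = "\<Prod>p\<in>P-{q}. real p ^ h p"
  have W0: "?W > 0" by (rule prod_pos) (use ge_2 in fastforce)
  have q1: "real q > 1" using ge_2[OF q] by simp
  obtain n0 where "T / ?W < real q ^ n0" using real_arch_pow[OF q1] by blast
  then have ex: "T \<le> real q ^ n0 * ?W" using W0 by (simp add: field_simps)
  define n where "n = (LEAST n. T \<le> real q ^ n * ?W)"
  have n: "T \<le> real q ^ n * ?W" unfolding n_def
    by (rule LeastI[where P = "\<lambda>n. T \<le> real q ^ n * ?W", OF ex])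
  have "real q ^ n * ?W \<le> T * real q"
  proof (cases n)
    case 0
    have "?W * 1 \<le> T * real q" using W W0 q1 by (intro mult_mono) auto
    with 0 show ?thesis by simp
  next
    case (Suc l)
    then have "\<not> T \<le> real q ^ l * ?W"
      using not_less_Least[of l "\<lambda>n. T \<le> real q ^ n * ?W"] unfolding n_def by simp
    then have "real q ^ l * ?W * real q \<le> T * real q" using q1 by (intro mult_right_mono) auto
    then show ?thesis by (simp add: Suc mult_ac)
  qed
  with n show ?thesis by (auto simp: modulus_upd[OF q])
qed

text \<open>Exponents below \<open>m\<close> are chosen freely at all primes but \<open>q\<close>.
  The condition on \<open>m\<close> keeps their product at most \<open>T\<close>, so an exponent of
  \<open>q\<close> brings the modulus into the range from \<open>T\<close> to \<open>T * q\<close>.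
  Exact points make the families disjoint.\<close>

lemma card_close_points_shell_ge:
  assumes compat: "\<And>p m n. p \<in> P \<Longrightarrow> m \<le> n \<Longrightarrow> a p n mod int p ^ m = a p m"
    and q: "q \<in> P" and Y: "0 \<le> Y" and T: "1 \<le> T"
    and M: "\<And>p. p \<in> P \<Longrightarrow> real p \<le> M" and m: "M ^ (card P * m) \<le> T"
  shows "real m ^ (card P - 1) * (Y / (T * (real q * real (\<Prod>P))) - 1)
    \<le> real (card {x \<in> close_points (\<lambda>p. {a p}) T. \<bar>real_of_int x\<bar> \<le> Y})"
proof -
  let ?H = "PiE (P - {q}) (\<lambda>_. {..<m})"
  let ?S = "\<lambda>k. {x \<in> exact_points a k. \<bar>real_of_int x\<bar> \<le> Y}"
  have M1: "M \<ge> 1" using M[OF q] ge_2[OF q] by simp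
  have finS: "finite {x \<in> A. \<bar>real_of_int x\<bar> \<le> Y}" for A
    by (rule finite_subset[OF _ finite_ints_abs_le[of Y]]) auto
  have "\<exists>n. T \<le> modulus (h(q := n)) \<and> modulus (h(q := n)) \<le> T * real q" if h: "h \<in> ?H" for h
  proof (rule exponent_completing[OF q])
    have "(\<Prod>p\<in>P-{q}. real p ^ h p) \<le> (\<Prod>p\<in>P-{q}. M ^ m)"
    proof (rule prod_mono)
      fix p assume p: "p \<in> P - {q}"
      have "real p ^ h p \<le> M ^ h p" using M p by (intro power_mono) auto
      also have "\<dots> \<le> M ^ m" using h p M1 by (intro power_increasing) (auto simp: PiE_def Pi_def less_imp_le)
      finally show "0 \<le> real p ^ h p \<and> real p ^ h p \<le> M ^ m" by simp
    qed
    also have "\<dots> = M ^ (m * (card P - 1))" using q finite_P by (simp add: power_mult)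
    also have "\<dots> \<le> M ^ (card P * m)" using M1 by (intro power_increasing) auto
    finally show "(\<Prod>p\<in>P-{q}. real p ^ h p) \<le> T" using m by simp
  qed
  then obtain e where e: "\<And>h. h \<in> ?H \<Longrightarrow> T \<le> modulus (h(q := e h))"
    "\<And>h. h \<in> ?H \<Longrightarrow> modulus (h(q := e h)) \<le> T * real q" by metis
  have finH: "finite ?H" using finite_P by (intro finite_PiE) auto
  have PP: "real (\<Prod>P) > 0" using ge_2 by (fastforce intro!: prod_pos simp flip: of_nat_0_less_iff)
  have "real m ^ (card P - 1) = real (card ?H)" using finite_P q by (simp add: card_PiE)
  also have "real (card ?H) * (Y / (T * (real q * real (\<Prod>P))) - 1) \<le> (\<Sum>h\<in>?H. real (card (?S (h(q := e h)))))"
  proof (rule sum_bounded_below)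
    fix h assume h: "h \<in> ?H"
    have "Y / (T * (real q * real (\<Prod>P))) \<le> Y / (modulus (h(q := e h)) * real (\<Prod>P))"
      unfolding mult.assoc[symmetric]
      using e(2)[OF h] modulus_ge_1[of "h(q := e h)"] Y PP T ge_2[OF q]
      by (intro divide_left_mono mult_right_mono mult_pos_pos) auto
    with card_exact_points_ge[where k = "h(q := e h)", OF compat Y]
    show "Y / (T * (real q * real (\<Prod>P))) - 1 \<le> real (card (?S (h(q := e h))))" by linarith
  qed
  also have "\<dots> = real (card (\<Union>h\<in>?H. ?S (h(q := e h))))"
  proof (subst card_UN_disjoint)
    show "\<forall>h\<in>?H. \<forall>h'\<in>?H. h \<noteq> h' \<longrightarrow> ?S (h(q := e h)) \<inter> ?S (h'(q := e h')) = {}"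
    proof (intro ballI impI, rule ccontr)
      fix h h' assume h: "h \<in> ?H" "h' \<in> ?H" and ne: "h \<noteq> h'"
        and "?S (h(q := e h)) \<inter> ?S (h'(q := e h')) \<noteq> {}"
      then obtain x where "x \<in> exact_points a (h(q := e h))" "x \<in> exact_points a (h'(q := e h'))" by blast
      from exact_points_disjoint[OF compat this]
      have eq: "(h(q := e h)) p = (h'(q := e h')) p" if "p \<in> P" for p using that by blast
      have "h = h'"
        by (rule PiE_ext[OF h]) (use eq in \<open>metis DiffD1 DiffD2 fun_upd_other singletonI\<close>)
      with ne show False ..
    qed
  qed (use finH finS in auto)
  also have "\<dots> \<le> real (card {x \<in> close_points (\<lambda>p. {a p}) T. \<bar>real_of_int x\<bar> \<le> Y})"
  proof (intro of_nat_mono card_mono finS)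
    show "(\<Union>h\<in>?H. ?S (h(q := e h))) \<subseteq> {x \<in> close_points (\<lambda>p. {a p}) T. \<bar>real_of_int x\<bar> \<le> Y}"
    proof
      fix x assume "x \<in> (\<Union>h\<in>?H. ?S (h(q := e h)))"
      then obtain h where h: "h \<in> ?H" "x \<in> exact_points a (h(q := e h))" "\<bar>real_of_int x\<bar> \<le> Y" by blast
      then have "x \<in> close_points (\<lambda>p. {a p}) T"
        unfolding close_points_def exact_points_def using e(1)[OF h(1)]
        by (intro CollectI exI[of _ "h(q := e h)"] exI[of _ a]) auto
      with h(3) show "x \<in> {x \<in> close_points (\<lambda>p. {a p}) T. \<bar>real_of_int x\<bar> \<le> Y}" by simp
    qed
  qed
  finally show ?thesis .
qed

text \<open>Here the threshold is the same for all \<open>x\<close> up to \<open>B\<close>, so one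
  application of the shell estimate with \<open>m\<close> of order \<open>ln B\<close> is
  enough.\<close>

lemma card_close_points_ge:
  assumes compat: "\<And>p m n. p \<in> P \<Longrightarrow> m \<le> n \<Longrightarrow> a p n mod int p ^ m = a p m"
    and \<alpha>: "0 < \<alpha>" "\<alpha> < 1" and C: "C > 0"
  shows "\<exists>c>0. \<forall>\<^sub>F B in at_top. c * (B powr (1 - \<alpha>) * ln B ^ (card P - 1))
    \<le> real (card {x \<in> close_points (\<lambda>p. {a p}) (C * B powr \<alpha>). \<bar>real_of_int x\<bar> \<le> B})"
proof -
  obtain q where q: "q \<in> P" using P_nonempty by blast
  define M where "M = real (Max P)"
  have M: "real p \<le> M" if "p \<in> P" for p using that finite_P by (simp add: M_def)
  have M1: "M > 1" using M[OF q] ge_2[OF q] by simp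
  define D where "D = real q * real (\<Prod>P)"
  have D: "D > 0"
    using ge_2 ge_2[OF q] unfolding D_def
    by (intro mult_pos_pos) (fastforce intro!: prod_pos simp flip: of_nat_0_less_iff)+
  \<comment> \<open>Then \<open>M ^ (card P * m)\<close> equals \<open>exp (K * m)\<close>, so the
    floor of \<open>ln T / K\<close> is an admissible \<open>m\<close>.\<close>
  define K where "K = real (card P) * ln M"
  have K: "K > 0"
    unfolding K_def using M1 q finite_P by (intro mult_pos_pos) (auto simp: card_gt_0_iff)
  \<comment> \<open>Half of the slope of \<open>ln T / K\<close> in \<open>ln B\<close>; the other
    half absorbs \<open>ln C / K\<close> and the rounding of \<open>m\<close>.\<close>
  define \<delta> where "\<delta> = \<alpha> / (2 * K)"
  have \<delta>: "\<delta> > 0" using \<alpha> K by (simp add: \<delta>_def)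
  define s where "s = card P - 1"
  \<comment> \<open>The factor 2 pays for the subtracted 1 in the shell estimate, once
    \<open>B / (T * D)\<close> is at least 2.\<close>
  define c where "c = \<delta> ^ s / (2 * C * D)"
  have "c > 0" using \<delta> C D by (simp add: c_def)
  have "\<forall>\<^sub>F B in at_top. ln B \<ge> L" for L :: real by real_asymp
  moreover have "\<forall>\<^sub>F B in at_top. B powr \<beta> \<ge> L" if "\<beta> > 0" for L \<beta> :: real using that by real_asymp
  ultimately have "\<forall>\<^sub>F B in at_top. B > 1 \<and> ln B \<ge> (1 - ln C / K) / \<delta> \<and> B powr (1 - \<alpha>) \<ge> 2 * C * D
      \<and> B powr \<alpha> \<ge> 1 / C"
    using \<alpha> by (intro eventually_conj eventually_gt_at_top) auto
  then have "\<forall>\<^sub>F B in at_top. c * (B powr (1 - \<alpha>) * ln B ^ s)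
    \<le> real (card {x \<in> close_points (\<lambda>p. {a p}) (C * B powr \<alpha>). \<bar>real_of_int x\<bar> \<le> B})"
  proof (eventually_elim)
    case (elim B)
    define T where "T = C * B powr \<alpha>"
    have T: "T \<ge> 1" using elim C by (simp add: T_def field_simps)
    define m where "m = nat \<lfloor>ln T / K\<rfloor>"
    have "ln T / K \<ge> 0" using T K by simp
    then have m: "real m \<le> ln T / K" "real m \<ge> ln T / K - 1" unfolding m_def by linarith+
    have "M ^ (card P * m) = exp (K * real m)"
      using M1 by (simp add: K_def exp_of_nat_mult[symmetric] powr_def flip: powr_realpow)
    also have "\<dots> \<le> exp (ln T)" using m(1) K by (simp add: field_simps)
    also have "\<dots> = T" using T by simp
    finally have MT: "M ^ (card P * m) \<le> T" .
    have lnT: "ln T = ln C + \<alpha> * ln B" using C elim by (simp add: T_def ln_mult ln_powr)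
    have "\<delta> * ln B \<ge> 1 - ln C / K" using elim \<delta> by (simp add: field_simps)
    moreover have "ln T / K = ln C / K + 2 * (\<delta> * ln B)"
      using K by (simp add: lnT \<delta>_def field_simps)
    ultimately have m2: "real m \<ge> \<delta> * ln B" using m(2) by linarith
    have "B / T = B powr (1 - \<alpha>) / C" using elim C by (simp add: T_def powr_diff)
    then have BT: "B / (T * D) = B powr (1 - \<alpha>) / (C * D)" by (metis divide_divide_eq_left)
    have "2 \<le> B powr (1 - \<alpha>) / (C * D)" using elim C D by (simp add: le_divide_eq mult_ac)
    moreover have "B powr (1 - \<alpha>) / (2 * C * D) = B powr (1 - \<alpha>) / (C * D) / 2" by simp
    ultimately have half: "B powr (1 - \<alpha>) / (2 * C * D) \<le> B / (T * D) - 1"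
      unfolding BT by linarith
    have "c * (B powr (1 - \<alpha>) * ln B ^ s) = (\<delta> * ln B) ^ s * (B powr (1 - \<alpha>) / (2 * C * D))"
      by (simp add: c_def power_mult_distrib)
    also have "\<dots> \<le> real m ^ s * (B / (T * D) - 1)"
      using m2 half \<delta> elim C D by (intro mult_mono power_mono) auto
    also have "\<dots> \<le> real (card {x \<in> close_points (\<lambda>p. {a p}) T. \<bar>real_of_int x\<bar> \<le> B})"
      unfolding s_def D_def using elim
      by (intro card_close_points_shell_ge[OF compat q _ T M MT]) auto
    finally show ?case by (simp add: T_def)
  qed
  with \<open>c > 0\<close> show ?thesis unfolding s_def by blast
qed

end

section \<open>The normalized S-part\<close>

lemma abs_poly_le:
  fixes f :: "int poly"
  shows "\<exists>C>0. \<forall>B\<ge>1. \<forall>x. \<bar>real_of_int x\<bar> \<le> B \<longrightarrow> \<bar>real_of_int (poly f x)\<bar> \<le> C * B ^ degree f"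
proof -
  define C where "C = 1 + (\<Sum>i\<le>degree f. \<bar>real_of_int (coeff f i)\<bar>)"
  have "\<bar>real_of_int (poly f x)\<bar> \<le> C * B ^ degree f" if B: "B \<ge> 1" "\<bar>real_of_int x\<bar> \<le> B" for B x
  proof -
    have "\<bar>real_of_int (poly f x)\<bar> \<le> (\<Sum>i\<le>degree f. \<bar>real_of_int (coeff f i)\<bar> * \<bar>real_of_int x\<bar> ^ i)"
      unfolding poly_altdef of_int_sum
      by (rule order_trans[OF sum_abs]) (simp add: abs_mult power_abs)
    also have "\<dots> \<le> (\<Sum>i\<le>degree f. \<bar>real_of_int (coeff f i)\<bar> * B ^ degree f)"
    proof (intro sum_mono mult_left_mono)
      fix i assume "i \<in> {..degree f}"
      then show "\<bar>real_of_int x\<bar> ^ i \<le> B ^ degree f"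
        using B power_mono[of "\<bar>real_of_int x\<bar>" B i] power_increasing[of i "degree f" B] by simp
    qed simp
    also have "\<dots> \<le> C * B ^ degree f"
      using B by (simp add: C_def sum_distrib_right[symmetric] distrib_right)
    finally show ?thesis .
  qed
  moreover have "C > 0" by (auto simp: C_def intro!: add_pos_nonneg sum_nonneg)
  ultimately show ?thesis by blast
qed

text \<open>For large \<open>x\<close> the leading term is at least twice the rest. For the
  remaining \<open>x\<close> it is integrality that helps: a non-zero value has absolute value at
  least 1.\<close>

lemma abs_poly_ge:
  fixes f :: "int poly"
  assumes "degree f \<ge> 1"
  shows "\<exists>c>0. \<forall>x. poly f x \<noteq> 0 \<longrightarrow> c * \<bar>real_of_int x\<bar> ^ degree f \<le> \<bar>real_of_int (poly f x)\<bar>"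
proof -
  obtain n where n: "degree f = Suc n" using assms by (cases "degree f") auto
  define a where "a = real_of_int (lead_coeff f)"
  have "f \<noteq> 0" using n by auto
  then have "lead_coeff f \<noteq> 0" by (rule leading_coeff_neq_0)
  then have a: "\<bar>a\<bar> \<ge> 1" unfolding a_def by linarith
  define C where "C = 1 + (\<Sum>i\<le>n. \<bar>real_of_int (coeff f i)\<bar>)"
  have C: "C \<ge> 1" by (auto simp: C_def intro!: sum_nonneg)
  \<comment> \<open>This makes \<open>c * (2 * C) ^ degree f = 1\<close> for small \<open>x\<close>
    and gives \<open>c\<close> at most 1/2 for large \<open>x\<close>.\<close>
  define c where "c = 1 / (2 * C) ^ Suc n"
  have c0: "c > 0" using C by (simp add: c_def)
  have "1 \<le> (2 * C) ^ n" using C by (intro one_le_power) simp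
  then have "2 * 1 \<le> 2 * C * (2 * C) ^ n" using C by (intro mult_mono) auto
  then have c_half: "c \<le> 1 / 2" using C unfolding c_def by (intro divide_left_mono) auto
  have "c * \<bar>real_of_int x\<bar> ^ degree f \<le> \<bar>real_of_int (poly f x)\<bar>" if fx: "poly f x \<noteq> 0" for x
  proof (cases "\<bar>real_of_int x\<bar> \<le> 2 * C")
    case True
    then have "\<bar>real_of_int x\<bar> ^ Suc n \<le> (2 * C) ^ Suc n" by (intro power_mono) auto
    then have "c * \<bar>real_of_int x\<bar> ^ Suc n \<le> 1" using C by (simp add: c_def)
    moreover have "\<bar>real_of_int (poly f x)\<bar> \<ge> 1" using fx by linarith
    ultimately show ?thesis unfolding n by linarith
  next
    case False
    define y where "y = \<bar>real_of_int x\<bar>"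
    have y: "y \<ge> 1" "2 * C \<le> y" using False C by (auto simp: y_def)
    define r where "r = (\<Sum>i\<le>n. real_of_int (coeff f i) * real_of_int x ^ i)"
    have fx_eq: "real_of_int (poly f x) = r + a * real_of_int x ^ Suc n"
      unfolding poly_altdef n by (simp add: r_def a_def n)
    have "\<bar>r\<bar> \<le> (\<Sum>i\<le>n. \<bar>real_of_int (coeff f i)\<bar> * y ^ i)"
      unfolding r_def y_def by (rule order_trans[OF sum_abs]) (simp add: abs_mult power_abs)
    also have "\<dots> \<le> (\<Sum>i\<le>n. \<bar>real_of_int (coeff f i)\<bar> * y ^ n)"
      using y by (intro sum_mono mult_left_mono power_increasing) auto
    also have "\<dots> \<le> C * y ^ n"
      using y by (simp add: C_def sum_distrib_right[symmetric] distrib_right)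
    finally have "2 * \<bar>r\<bar> \<le> 2 * C * y ^ n" by simp
    also have "\<dots> \<le> y * y ^ n" using y by (intro mult_right_mono) auto
    finally have r: "2 * \<bar>r\<bar> \<le> y ^ Suc n" by simp
    have "\<bar>a * real_of_int x ^ Suc n\<bar> = \<bar>a\<bar> * y ^ Suc n" by (simp add: abs_mult power_abs y_def)
    moreover have "1 * y ^ Suc n \<le> \<bar>a\<bar> * y ^ Suc n" using a y by (intro mult_right_mono) auto
    ultimately have "\<bar>real_of_int (poly f x)\<bar> \<ge> y ^ Suc n / 2" unfolding fx_eq using r by linarith
    moreover have "c * y ^ Suc n \<le> 1 / 2 * y ^ Suc n" using c_half y by (intro mult_right_mono) auto
    ultimately show ?thesis unfolding n y_def[symmetric] by linarith
  qed
  with c0 show ?thesis by blast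
qed

section \<open>Comparison of the normalized S-part with powers of moduli\<close>

lemma max_root_mult_pos:
  assumes "prime p" "is_padic_root p f a"
  shows "max_root_mult f p > 0"
  using padic_root_mult_pos[OF assms] padic_root_mult_le_max[OF assms] by linarith

lemma root_primes_subset: "root_primes f S \<subseteq> S"
  by (auto simp: root_primes_def)

lemma norm_exponent_nonneg: "norm_exponent f S p \<ge> 0"
  by (simp add: norm_exponent_def)

lemma norm_exponent_root_mult:
  assumes "prime p" "p \<in> root_primes f S"
  shows "real (max_root_mult f p) * norm_exponent f S p = real (max_root_mult_on f S)"
proof -
  have "max_root_mult f p > 0" using assms max_root_mult_pos by (auto simp: root_primes_def)
  then show ?thesis using assms(2) by (simp add: norm_exponent_def)
qed

text \<open>Padding with factors 1 turns this into a product over \<open>S\<close>, ready for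
  comparison with the normalized S-part factor by factor.\<close>

lemma prod_root_primes_powr:
  assumes S: "finite S" "0 \<notin> S"
  shows "(\<Prod>p\<in>root_primes f S. real p ^ k p) powr r
    = (\<Prod>p\<in>S. if p \<in> root_primes f S then real p powr (real (k p) * r) else 1)"
proof -
  have "(real p ^ k p) powr r = real p powr (real (k p) * r)" if "p \<in> root_primes f S" for p
  proof -
    have "p \<in> S" using that by (simp add: root_primes_def)
    with S(2) have "p \<noteq> 0" by metis
    then have "real p ^ k p = real p powr real (k p)" by (simp add: powr_realpow)
    then show ?thesis by (simp only: powr_powr)
  qed
  then have "(\<Prod>p\<in>root_primes f S. real p ^ k p) powr r
      = (\<Prod>p\<in>root_primes f S. real p powr (real (k p) * r))"
    by (simp add: prod_powr_distrib)
  also have "\<dots> = (\<Prod>p\<in>S. if p \<in> root_primes f S then real p powr (real (k p) * r) else 1)"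
    using S(1) root_primes_subset[of f S] by (simp add: prod.If_cases Int_absorb1)
  finally show ?thesis .
qed

text \<open>The valuation at \<open>p\<close> is at least \<open>max_root_mult f p * k p\<close>,
  and the normalizing exponent replaces the multiplicity by the common maximum. Primes of
  \<open>S\<close> outside \<open>root_primes f S\<close> contribute factors at least 1.\<close>

lemma normalized_S_part_ge:
  assumes S: "finite S" "\<And>p. p \<in> S \<Longrightarrow> prime p" and fx: "poly f x \<noteq> 0"
    and a: "\<And>p. p \<in> root_primes f S \<Longrightarrow> is_padic_root p f (a p)"
    and mult: "\<And>p. p \<in> root_primes f S \<Longrightarrow> padic_root_mult p f (a p) = max_root_mult f p"
    and x: "\<And>p. p \<in> root_primes f S \<Longrightarrow> x mod int p ^ k p = a p (k p)"
  shows "(\<Prod>p\<in>root_primes f S. real p ^ k p) powr real (max_root_mult_on f S)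
    \<le> normalized_S_part f S (poly f x)"
proof -
  have "0 \<notin> S" using S(2) not_prime_0 by blast
  show ?thesis
    unfolding prod_root_primes_powr[OF S(1) \<open>0 \<notin> S\<close>] normalized_S_part_def
  proof (rule prod_mono)
    fix p assume p: "p \<in> S"
    have p1: "real p > 1" using prime_gt_1_nat[OF S(2)[OF p]] by simp
    let ?v = "multiplicity (int p) (poly f x)"
    have "(if p \<in> root_primes f S then real p powr (real (k p) * real (max_root_mult_on f S)) else 1)
        \<le> real p powr (real ?v * norm_exponent f S p)"
    proof (cases "p \<in> root_primes f S")
      case True
      have "f \<noteq> 0" using fx by auto
      from padic_root_power_dvd[OF S(2)[OF p] this padic_root_in_carrier[OF a[OF True]] x[OF True]]
      have "int p ^ (max_root_mult f p * k p) dvd poly f x"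
        unfolding mult[OF True] .
      then have "max_root_mult f p * k p \<le> ?v"
        using fx p1 by (intro multiplicity_geI) auto
      then have "real (max_root_mult f p * k p) * norm_exponent f S p \<le> real ?v * norm_exponent f S p"
        by (intro mult_right_mono of_nat_mono norm_exponent_nonneg)
      moreover have "real (max_root_mult f p * k p) * norm_exponent f S p
          = real (k p) * real (max_root_mult_on f S)"
        using norm_exponent_root_mult[OF S(2)[OF p] True] by simp
      ultimately have "real (k p) * real (max_root_mult_on f S) \<le> real ?v * norm_exponent f S p"
        by (simp only:)
      then show ?thesis using True p1 by simp
    next
      case False
      then show ?thesis
        using p1 norm_exponent_nonneg[of f S p] by (auto intro!: ge_one_powr_ge_zero mult_nonneg_nonneg)
    qed
    then show "0 \<le> (if p \<in> root_primes f S then real p powr (real (k p) * real (max_root_mult_on f S)) else 1) \<and>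
      (if p \<in> root_primes f S then real p powr (real (k p) * real (max_root_mult_on f S)) else 1)
        \<le> real p powr (real ?v * norm_exponent f S p)" by simp
  qed
qed

text \<open>The bounded errors of \<open>padic_valuation_bound\<close> are collected in
  \<open>Q\<close>, prime by prime. At primes without a root they bound the whole valuation.\<close>

lemma normalized_S_part_le:
  assumes S: "finite S" "\<And>p. p \<in> S \<Longrightarrow> prime p" and f: "f \<noteq> 0"
  shows "\<exists>Q>0. \<forall>x. poly f x \<noteq> 0 \<longrightarrow>
    (\<exists>k a. (\<forall>p\<in>root_primes f S. is_padic_root p f (a p) \<and> x mod int p ^ k p = a p (k p)) \<and>
      normalized_S_part f S (poly f x)
        \<le> Q * (\<Prod>p\<in>root_primes f S. real p ^ k p) powr real (max_root_mult_on f S))"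
proof -
  let ?v = "\<lambda>p x. multiplicity (int p) (poly f x)"
  have "\<forall>p\<in>S. \<exists>C. \<forall>x. poly f x \<noteq> 0 \<longrightarrow> ?v p x \<le> C \<or>
    (\<exists>a j. is_padic_root p f a \<and> x mod int p ^ j = a j \<and> ?v p x \<le> max_root_mult f p * j + C)"
    using padic_valuation_bound[OF S(2) f] by blast
  then obtain C where C: "\<And>p x. p \<in> S \<Longrightarrow> poly f x \<noteq> 0 \<Longrightarrow> ?v p x \<le> C p \<or>
    (\<exists>a j. is_padic_root p f a \<and> x mod int p ^ j = a j \<and> ?v p x \<le> max_root_mult f p * j + C p)"
    by metis
  have "0 \<notin> S" using S(2) not_prime_0 by blast
  define q where "q p = real p powr (real (C p) * norm_exponent f S p)" for p
  define Q where "Q = prod q S"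
  have p1: "real p > 1" if "p \<in> S" for p using prime_gt_1_nat[OF S(2)[OF that]] by simp
  have "Q > 0" unfolding Q_def q_def by (rule prod_pos) (use p1 in force)
  moreover have "\<exists>k a. (\<forall>p\<in>root_primes f S. is_padic_root p f (a p) \<and> x mod int p ^ k p = a p (k p)) \<and>
      normalized_S_part f S (poly f x)
        \<le> Q * (\<Prod>p\<in>root_primes f S. real p ^ k p) powr real (max_root_mult_on f S)"
    if fx: "poly f x \<noteq> 0" for x
  proof -
    have "\<exists>j a. is_padic_root p f a \<and> x mod int p ^ j = a j \<and> ?v p x \<le> max_root_mult f p * j + C p"
      if p: "p \<in> root_primes f S" for p
    proof -
      obtain b where b: "is_padic_root p f b" using p by (auto simp: root_primes_def)
      \<comment> \<open>If only the bound \<open>C p\<close> is available, any root \<open>b\<close>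
        with exponent 0 is a valid witness.\<close>
      have "b 0 mod 1 = b 0"
        using padic_ints_compat[OF padic_root_in_carrier[OF b], of 0 0] by simp
      then have "x mod int p ^ 0 = b 0" by simp
      with C[of p x] fx p b root_primes_subset[of f S] show ?thesis
        by (metis add_cancel_left_left mult_0_right subsetD)
    qed
    then obtain k a where ka: "\<And>p. p \<in> root_primes f S \<Longrightarrow> is_padic_root p f (a p)"
      "\<And>p. p \<in> root_primes f S \<Longrightarrow> x mod int p ^ k p = a p (k p)"
      "\<And>p. p \<in> root_primes f S \<Longrightarrow> ?v p x \<le> max_root_mult f p * k p + C p" by metis
    have "normalized_S_part f S (poly f x) \<le> Q * (\<Prod>p\<in>root_primes f S. real p ^ k p) powr real (max_root_mult_on f S)"
      unfolding prod_root_primes_powr[OF S(1) \<open>0 \<notin> S\<close>] normalized_S_part_def Q_def prod.distrib[symmetric]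
    proof (rule prod_mono)
      fix p assume p: "p \<in> S"
      let ?e = "norm_exponent f S p"
      have "real p powr (real (?v p x) * ?e)
        \<le> q p * (if p \<in> root_primes f S then real p powr (real (k p) * real (max_root_mult_on f S)) else 1)"
      proof (cases "p \<in> root_primes f S")
        case True
        have "real (?v p x) * ?e \<le> real (max_root_mult f p * k p + C p) * ?e"
          using ka(3)[OF True] by (intro mult_right_mono of_nat_mono norm_exponent_nonneg)
        also have "\<dots> = real (C p) * ?e + real (k p) * real (max_root_mult_on f S)"
          by (simp add: algebra_simps norm_exponent_root_mult[OF S(2)[OF p] True, symmetric])
        finally show ?thesis using True p1[OF p] by (simp add: q_def powr_add[symmetric])
      next
        case False
        then have "?v p x \<le> C p" using C[OF p fx] p by (auto simp: root_primes_def)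
        then have "real (?v p x) * ?e \<le> real (C p) * ?e"
          by (intro mult_right_mono of_nat_mono norm_exponent_nonneg)
        then show ?thesis using False p1[OF p] by (simp add: q_def)
      qed
      then show "0 \<le> real p powr (real (?v p x) * ?e) \<and> real p powr (real (?v p x) * ?e)
        \<le> q p * (if p \<in> root_primes f S then real p powr (real (k p) * real (max_root_mult_on f S)) else 1)"
        by simp
    qed
    with ka show ?thesis by blast
  qed
  ultimately show ?thesis by blast
qed

section \<open>The two-sided estimate for the counting function\<close>

theorem theorem2:
  fixes f :: "int poly" and n :: nat and S S' :: "nat set" and s' :: nat and R \<epsilon> :: real
  assumes "n = Polynomial.degree f" and "n \<ge> 1"
    and "finite S" and "\<And>p. p \<in> S \<Longrightarrow> prime p"
    and "S' = root_primes f S" and "s' = card S'" and "s' \<ge> 1"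
    and "R = real (max_root_mult_on f S)"
    and "0 < \<epsilon>" and "\<epsilon> < R / real n"
  shows "\<exists>c\<^sub>1 c\<^sub>2 :: real. c\<^sub>1 > 0 \<and> c\<^sub>2 > 0 \<and>
    (\<forall>\<^sub>F B :: real in at_top.
      c\<^sub>1 * (B powr (1 - real n * \<epsilon> / R) * ln B ^ (s' - 1)) \<le> real (count_S_part f S \<epsilon> B) \<and>
      real (count_S_part f S \<epsilon> B) \<le> c\<^sub>2 * (B powr (1 - real n * \<epsilon> / R) * ln B ^ (s' - 1)))"
proof -
  note n = assms(1) and S = assms(3,4)
  have sub: "S' \<subseteq> S" unfolding assms(5) by (rule root_primes_subset)
  interpret finite_primes S'
    using sub S assms(6,7) by unfold_locales (auto intro: finite_subset)
  have f: "f \<noteq> 0" using assms(1,2) by auto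
  have R: "R > 0" using assms(2,9,10) by (smt (verit) divide_nonpos_nonneg of_nat_0_le_iff)
  \<comment> \<open>Since \<open>\<alpha> * R = n * \<epsilon>\<close>, comparing
    \<open>modulus k powr R\<close> with the size of \<open>\<bar>f x\<bar> powr \<epsilon>\<close>
    means comparing \<open>modulus k\<close> with
    \<open>\<bar>x\<bar> powr \<alpha>\<close>.\<close>
  define \<alpha> where "\<alpha> = real n * \<epsilon> / R"
  have \<alpha>: "0 < \<alpha>" "\<alpha> < 1" using assms(2,9,10) R by (auto simp: \<alpha>_def field_simps)
  have \<alpha>R: "\<alpha> * R = real n * \<epsilon>" using R by (simp add: \<alpha>_def)
  define good where "good B = {x :: int. \<bar>real_of_int x\<bar> \<le> B \<and>
      0 < \<bar>real_of_int (poly f x)\<bar> powr \<epsilon> \<and>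
      \<bar>real_of_int (poly f x)\<bar> powr \<epsilon> \<le> normalized_S_part f S (poly f x)}" for B
  have count: "count_S_part f S \<epsilon> B = card (good B)" for B
    by (simp add: count_S_part_def good_def)
  have fin_good: "finite (good B)" for B
    by (rule finite_subset[OF _ finite_ints_abs_le[of B]]) (auto simp: good_def)
  have root_compat: "a n mod int p ^ m = a m" if "is_padic_root p f a" "m \<le> n" for p a m n
    using padic_ints_compat[OF padic_root_in_carrier[OF that(1)] that(2)] .

  have upper: "\<exists>c>0. \<forall>B\<ge>2. real (card (good B)) \<le> c * (B powr (1 - \<alpha>) * ln B ^ (s' - 1))"
  proof -
    obtain c where c: "c > 0" "\<And>x. poly f x \<noteq> 0 \<Longrightarrow> c * \<bar>real_of_int x\<bar> ^ n \<le> \<bar>real_of_int (poly f x)\<bar>"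
      using abs_poly_ge[of f] assms(1,2) by blast
    have "\<exists>Q>0. \<forall>x. poly f x \<noteq> 0 \<longrightarrow>
      (\<exists>k a. (\<forall>p\<in>S'. is_padic_root p f (a p) \<and> x mod int p ^ k p = a p (k p)) \<and>
        normalized_S_part f S (poly f x) \<le> Q * modulus k powr R)"
      unfolding modulus_def unfolding assms(5,8) by (rule normalized_S_part_le[OF S f])
    then obtain Q where Q: "Q > 0" "\<forall>x. poly f x \<noteq> 0 \<longrightarrow>
      (\<exists>k a. (\<forall>p\<in>S'. is_padic_root p f (a p) \<and> x mod int p ^ k p = a p (k p)) \<and>
        normalized_S_part f S (poly f x) \<le> Q * modulus k powr R)" by blast
    \<comment> \<open>Chosen so that \<open>d powr R = c powr \<epsilon> / Q\<close>, which carries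
      both the growth constant of \<open>f\<close> and the error \<open>Q\<close>.\<close>
    define d where "d = (c powr \<epsilon> / Q) powr (1 / R)"
    have d: "d > 0" using c Q by (simp add: d_def)
    have dR: "d powr R = c powr \<epsilon> / Q" using c Q R by (simp add: d_def powr_powr)
    let ?A = "padic_root_set f"
    have "\<exists>C>0. \<forall>B\<ge>2.
      real (card {x. \<bar>real_of_int x\<bar> \<le> B \<and> x \<in> close_points ?A (d * \<bar>real_of_int x\<bar> powr \<alpha>)})
        \<le> C * (B powr (1 - \<alpha>) * ln B ^ (s' - 1))"
      unfolding assms(6)
      by (rule card_close_points_le[OF _ _ \<alpha> d]) (auto intro: finite_padic_roots prime_P root_compat)
    then obtain C where C: "C > 0" "\<And>B. B \<ge> 2 \<Longrightarrow>
      real (card {x. \<bar>real_of_int x\<bar> \<le> B \<and> x \<in> close_points ?A (d * \<bar>real_of_int x\<bar> powr \<alpha>)})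
        \<le> C * (B powr (1 - \<alpha>) * ln B ^ (s' - 1))" by blast
    have "good B \<subseteq> {x. \<bar>real_of_int x\<bar> \<le> B \<and> x \<in> close_points ?A (d * \<bar>real_of_int x\<bar> powr \<alpha>)}" for B
    proof
      fix x assume x: "x \<in> good B"
      then have fx: "poly f x \<noteq> 0" by (auto simp: good_def)
      obtain k a where ka: "\<forall>p\<in>S'. is_padic_root p f (a p) \<and> x mod int p ^ k p = a p (k p)"
        "normalized_S_part f S (poly f x) \<le> Q * modulus k powr R"
        using Q(2) fx by blast
      have "d * \<bar>real_of_int x\<bar> powr \<alpha> \<le> modulus k"
      proof (cases "x = 0")
        case True
        then show ?thesis using modulus_ge_1[of k] by simp
      next
        case False
        let ?y = "\<bar>real_of_int x\<bar>"
        have "(d * ?y powr \<alpha>) powr R = c powr \<epsilon> / Q * ?y powr (real n * \<epsilon>)"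
          using d by (simp add: powr_mult dR powr_powr \<alpha>R)
        also have "\<dots> = (c * ?y ^ n) powr \<epsilon> / Q"
          using c(1) False by (simp add: powr_mult powr_powr flip: powr_realpow)
        also have "\<dots> \<le> \<bar>real_of_int (poly f x)\<bar> powr \<epsilon> / Q"
          using c Q(1) fx assms(9) by (intro divide_right_mono powr_mono2) auto
        also have "\<dots> \<le> (Q * modulus k powr R) / Q"
          using x ka(2) Q(1) by (intro divide_right_mono) (auto simp: good_def)
        also have "\<dots> = modulus k powr R" using Q(1) by simp
        finally have "(d * ?y powr \<alpha>) powr R \<le> modulus k powr R" .
        then show ?thesis
          using powr_less_mono2[OF R, of "modulus k" "d * ?y powr \<alpha>"] modulus_ge_1[of k] by force
      qed
      with ka(1) x show "x \<in> {x. \<bar>real_of_int x\<bar> \<le> B \<and> x \<in> close_points ?A (d * \<bar>real_of_int x\<bar> powr \<alpha>)}"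
        by (auto simp: close_points_def good_def)
    qed
    moreover have "finite {x. \<bar>real_of_int x\<bar> \<le> B \<and> x \<in> close_points ?A (d * \<bar>real_of_int x\<bar> powr \<alpha>)}" for B
      by (rule finite_subset[OF _ finite_ints_abs_le[of B]]) auto
    ultimately have "card (good B) \<le> card {x. \<bar>real_of_int x\<bar> \<le> B \<and> x \<in> close_points ?A (d * \<bar>real_of_int x\<bar> powr \<alpha>)}" for B
      by (simp add: card_mono)
    then have "real (card (good B)) \<le> C * (B powr (1 - \<alpha>) * ln B ^ (s' - 1))" if "B \<ge> 2" for B
      using C(2)[OF that] by (meson of_nat_mono order_trans)
    with C(1) show ?thesis by blast
  qed

  have lower: "\<exists>c>0. \<forall>\<^sub>F B in at_top. c * (B powr (1 - \<alpha>) * ln B ^ (s' - 1)) \<le> real (card (good B))"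
  proof -
    obtain D where D: "D > 0" "\<And>B x. B \<ge> 1 \<Longrightarrow> \<bar>real_of_int x\<bar> \<le> B \<Longrightarrow>
        \<bar>real_of_int (poly f x)\<bar> \<le> D * B ^ n"
      using abs_poly_le[of f] unfolding n by blast
    \<comment> \<open>Chosen so that \<open>C powr R = D powr \<epsilon>\<close>: a modulus above
      \<open>C * B powr \<alpha>\<close> then beats every value of \<open>f\<close> on the interval
      up to \<open>B\<close>.\<close>
    define C where "C = D powr (\<epsilon> / R)"
    have C: "C > 0" using D(1) by (simp add: C_def)
    have CR: "C powr R = D powr \<epsilon>" using R by (simp add: C_def powr_powr)
    have "\<exists>a. is_padic_root p f a \<and> padic_root_mult p f a = max_root_mult f p" if "p \<in> S'" for p
      using that max_root_mult_attained[OF prime_P[OF that]] unfolding assms(5) root_primes_def by blast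
    then obtain a where a: "\<And>p. p \<in> S' \<Longrightarrow> is_padic_root p f (a p)"
      "\<And>p. p \<in> S' \<Longrightarrow> padic_root_mult p f (a p) = max_root_mult f p" by metis
    let ?X = "\<lambda>B. {x \<in> close_points (\<lambda>p. {a p}) (C * B powr \<alpha>). \<bar>real_of_int x\<bar> \<le> B}"
    \<comment> \<open>Zeros of \<open>f\<close> may be close points but are excluded from the count;
      there are finitely many.\<close>
    let ?Z = "{x. poly f x = 0}"
    let ?g = "\<lambda>B. B powr (1 - \<alpha>) * ln B ^ (s' - 1)"
    have "\<exists>c>0. \<forall>\<^sub>F B in at_top. c * ?g B \<le> real (card (?X B))"
      unfolding assms(6) by (rule card_close_points_ge[OF _ \<alpha> C]) (rule root_compat[OF a(1)])
    then obtain c where c: "c > 0" "\<forall>\<^sub>F B in at_top. c * ?g B \<le> real (card (?X B))" by blast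
    have finZ: "finite ?Z" by (rule poly_roots_finite[OF f])
    have sub_good: "?X B - ?Z \<subseteq> good B" if B: "B \<ge> 1" for B
    proof
      fix x assume x: "x \<in> ?X B - ?Z"
      then have fx: "poly f x \<noteq> 0" by simp
      from x obtain k b where "\<forall>p\<in>S'. b p \<in> {a p} \<and> x mod int p ^ k p = b p (k p)"
        and k: "C * B powr \<alpha> \<le> modulus k"
        unfolding close_points_def by blast
      then have xk: "x mod int p ^ k p = a p (k p)" if "p \<in> S'" for p using that by auto
      have "\<bar>real_of_int (poly f x)\<bar> powr \<epsilon> \<le> (D * B ^ n) powr \<epsilon>"
        using D(2)[OF B, of x] x assms(9) by (intro powr_mono2) auto
      also have "\<dots> = (C * B powr \<alpha>) powr R"
        using C D(1) B by (simp add: powr_mult powr_powr \<alpha>R CR flip: powr_realpow)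
      also have "\<dots> \<le> modulus k powr R" using k C R by (intro powr_mono2) auto
      also have "\<dots> \<le> normalized_S_part f S (poly f x)"
        using normalized_S_part_ge[OF S fx a[unfolded assms(5)] xk[unfolded assms(5)]]
        unfolding modulus_def unfolding assms(5,8) .
      finally show "x \<in> good B" using x fx by (simp add: good_def)
    qed
    define z where "z = real (card ?Z)"
    have "\<forall>\<^sub>F B in at_top. ln B \<ge> (1::real)" by real_asymp
    moreover have "\<forall>\<^sub>F B in at_top. B powr (1 - \<alpha>) \<ge> 2 * z / c" using \<alpha> by real_asymp
    \<comment> \<open>Half of \<open>c\<close> is given up to cover the removed zeros.\<close>
    ultimately have "\<forall>\<^sub>F B in at_top. c / 2 * ?g B \<le> real (card (good B))"
      using c(2) eventually_ge_at_top[of 1]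
    proof eventually_elim
      case (elim B)
      have "1 \<le> ln B ^ (s' - 1)" using elim(1) by simp
      then have "B powr (1 - \<alpha>) * 1 \<le> ?g B" by (intro mult_left_mono) auto
      then have "2 * z / c \<le> ?g B" using elim(2) by linarith
      then have z: "z \<le> c / 2 * ?g B" using c(1) by (simp add: field_simps)
      have "card (?X B) - card ?Z \<le> card (?X B - ?Z)" by (rule diff_card_le_card_Diff[OF finZ])
      also have "\<dots> \<le> card (good B)" by (rule card_mono[OF fin_good sub_good[OF elim(4)]])
      finally have "real (card (?X B)) - z \<le> real (card (good B))" unfolding z_def by linarith
      with z elim(3) show ?case by (simp add: field_simps)
    qed
    with c(1) show ?thesis by (intro exI[of _ "c / 2"]) simp
  qed

  from upper obtain c\<^sub>2 where c2: "c\<^sub>2 > 0"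
    "\<And>B. B \<ge> 2 \<Longrightarrow> real (card (good B)) \<le> c\<^sub>2 * (B powr (1 - \<alpha>) * ln B ^ (s' - 1))" by blast
  from lower obtain c\<^sub>1 where c1: "c\<^sub>1 > 0"
    "\<forall>\<^sub>F B in at_top. c\<^sub>1 * (B powr (1 - \<alpha>) * ln B ^ (s' - 1)) \<le> real (card (good B))" by blast
  have "\<forall>\<^sub>F B in at_top. real (card (good B)) \<le> c\<^sub>2 * (B powr (1 - \<alpha>) * ln B ^ (s' - 1))"
    using eventually_ge_at_top[of 2] by eventually_elim (rule c2(2))
  with c1(2) have "\<forall>\<^sub>F B in at_top. c\<^sub>1 * (B powr (1 - \<alpha>) * ln B ^ (s' - 1)) \<le> real (card (good B)) \<and>
      real (card (good B)) \<le> c\<^sub>2 * (B powr (1 - \<alpha>) * ln B ^ (s' - 1))"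
    by (rule eventually_conj)
  with c1(1) c2(1) show ?thesis
    unfolding count \<alpha>_def[symmetric] by (intro exI conjI)
qed

end
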